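(* Let $d,n$ be positive integers. The space $\mathcal{C}(\mathbb{R}^d,\le n)$ is the union of the finitely many subspaces $\mathcal{C}_A$, indexed by the graphs $A$ on $\{1,\dots,n\}$ that occur as adjacency graphs $A(\mathcal{P})$ of partitions $\mathcal{P}\in\mathcal{C}(\mathbb{R}^d,\le n)$, and each $\mathcal{C}_A$ can be parameterized as a semialgebraic set. The same statement holds for $\mathcal{C}(\mathbb{R}^d,n)$: it is the union of finitely many subspaces $\mathcal{C}_A$, indexed by the adjacency graphs $A$ of partitions in $\mathcal{C}(\mathbb{R}^d,n)$, each of which can be parameterized as a semialgebraic set.
   Context: A proper convex $n$-partition of $\mathbb{R}^d$ is an ordered list $\mathcal{P}=(P_1,\dots,P_n)$ of non-empty open convex subsets of $\mathbb{R}^d$ that are pairwise disjoint and satisfy $\bigcup_{i=1}^n\overline{P_i}=\mathbb{R}^d$. A non-proper $n$-partition is defined in the same way except that the $P_i$ are allowed to be empty and at least one of them is empty. $\mathcal{C}(\mathbb{R}^d,n)$ is the set of proper $n$-partitions and $\mathcal{C}(\mathbb{R}^d,\le n)$ is the set of all proper or non-proper $n$-partitions. The adjacency graph $A(\mathcal{P})$ has vertex set $\{1,\dots,n\}$, and $\{i,j\}$ is an edge if and only if $P_i,P_j$ are non-empty and $\overline{P_i}\cap\overline{P_j}$ has dimension $d-1$. For a graph $A$ on $\{1,\dots,n\}$, $\mathcal{C}_A$ denotes the set of partitions $\mathcal{P}\in\mathcal{C}(\mathbb{R}^d,\le n)$ with $A(\mathcal{P})=A$. If $\{i,j\}$ with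 $i<j$ is an edge of $A(\mathcal{P})$, there is a unique unit vector $\mathbf{c}_{ij}=\mathbf{c}_{ij}(\mathcal{P})\in S^d\subset\mathbb{R}^{d+1}$ such that $\mathbf{c}_{ij}\cdot\binom{1}{\mathbf{x}}<0$ for all $\mathbf{x}\in P_i$ and $\mathbf{c}_{ij}\cdot\binom{1}{\mathbf{x}}>0$ for all $\mathbf{x}\in P_j$. The statement that $\mathcal{C}_A$ can be parameterized as a semialgebraic set means that the map $\mathcal{P}\mapsto(\mathbf{c}_{ij}(\mathcal{P}))_{\{i,j\}\in A}$ is a bijection from $\mathcal{C}_A$ onto a semialgebraic subset of $\mathbb{R}^{(d+1)\times E}$, where $E$ is the number of edges of $A$. In the degenerate case where $A$ has no edges, $\mathcal{C}_A$ consists of the $n$ partitions with exactly one non-empty region and is simply regarded as a finite (hence semialgebraic) set. A subset of $\mathbb{R}^m$ is semialgebraic if it is a finite union of solution sets of systems of finitely many polynomial equations and strict polynomial inequalities. *)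

theory Defs
  imports "HOL-Analysis.Analysis" "HOL-Library.Poly_Mapping"
begin

section \<open>Semialgebraic sets\<close>

text \<open>
  Polynomials with real coefficients in variables from \<open>'v\<close>: a finitely supported map from monomials
  (finitely supported exponent vectors) to coefficients.  For a finite index set \<open>I\<close>, the space
  \<open>\<real>\<^sup>I\<close> is the set \<open>I \<rightarrow>\<^sub>E UNIV\<close> of extensional functions.
\<close>

type_synonym 'v real_mpoly = "('v \<Rightarrow>\<^sub>0 nat) \<Rightarrow>\<^sub>0 real"

definition mpoly_eval :: "'v real_mpoly \<Rightarrow> ('v \<Rightarrow> real) \<Rightarrow> real" where
  "mpoly_eval p x =
     (\<Sum>m\<in>Poly_Mapping.keys p. Poly_Mapping.lookup p m *
        (\<Prod>v\<in>Poly_Mapping.keys m. x v ^ Poly_Mapping.lookup m v))"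

definition mpolys_in :: "'v set \<Rightarrow> 'v real_mpoly set" where
  "mpolys_in I = {p. \<forall>m\<in>Poly_Mapping.keys p. Poly_Mapping.keys m \<subseteq> I}"

definition basic_semialgebraic :: "'v set \<Rightarrow> ('v \<Rightarrow> real) set \<Rightarrow> bool" where
  "basic_semialgebraic I S \<longleftrightarrow>
     (\<exists>F G. finite F \<and> F \<subseteq> mpolys_in I \<and> finite G \<and> G \<subseteq> mpolys_in I \<and>
        S = {x \<in> I \<rightarrow>\<^sub>E UNIV. (\<forall>p\<in>F. mpoly_eval p x = 0) \<and> (\<forall>q\<in>G. mpoly_eval q x > 0)})"

definition semialgebraic :: "'v set \<Rightarrow> ('v \<Rightarrow> real) set \<Rightarrow> bool" where
  "semialgebraic I S \<longleftrightarrow>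
     (\<exists>\<S>. finite \<S> \<and> (\<forall>T\<in>\<S>. basic_semialgebraic I T) \<and> S = \<Union>\<S>)"


section \<open>Convex partitions of \<open>\<real>\<^sup>d\<close>\<close>

text \<open>
  The dimension \<open>d\<close> is \<open>CARD('d)\<close>.  A list \<open>(P\<^sub>1, \<dots>, P\<^sub>n)\<close> is a function on \<open>{1..n}\<close>, required to be
  extensional so that equality of functions is equality of lists.
\<close>

definition weak_convex_partition :: "nat \<Rightarrow> (nat \<Rightarrow> (real^'d) set) \<Rightarrow> bool" where
  "weak_convex_partition n P \<longleftrightarrow>
     P \<in> extensional {1..n} \<and>
     (\<forall>i\<in>{1..n}. open (P i) \<and> convex (P i)) \<and>
     disjoint_family_on P {1..n} \<and>
     (\<Union>i\<in>{1..n}. closure (P i)) = UNIV"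

definition proper_partitions :: "nat \<Rightarrow> (nat \<Rightarrow> (real^'d) set) set" where
  "proper_partitions n = {P. weak_convex_partition n P \<and> (\<forall>i\<in>{1..n}. P i \<noteq> {})}"

definition nonproper_partitions :: "nat \<Rightarrow> (nat \<Rightarrow> (real^'d) set) set" where
  "nonproper_partitions n = {P. weak_convex_partition n P \<and> (\<exists>i\<in>{1..n}. P i = {})}"

definition partitions_le :: "nat \<Rightarrow> (nat \<Rightarrow> (real^'d) set) set" where
  "partitions_le n = proper_partitions n \<union> nonproper_partitions n"

text \<open>A graph on the vertex set \<open>{1..n}\<close> is given by its set of edges, which are two-element sets.\<close>

definition adjacency_graph :: "nat \<Rightarrow> (nat \<Rightarrow> (real^'d) set) \<Rightarrow> nat set set" where
  "adjacency_graph n P =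
     {{i, j} | i j. i \<in> {1..n} \<and> j \<in> {1..n} \<and> i \<noteq> j \<and> P i \<noteq> {} \<and> P j \<noteq> {} \<and>
        aff_dim (closure (P i) \<inter> closure (P j)) = int CARD('d) - 1}"

definition partitions_with_graph :: "nat \<Rightarrow> nat set set \<Rightarrow> (nat \<Rightarrow> (real^'d) set) set" where
  "partitions_with_graph n A = {P \<in> partitions_le n. adjacency_graph n P = A}"


section \<open>The parameterization by unit normal vectors\<close>

text \<open>\<open>\<real>\<^sup>d\<^sup>+\<^sup>1\<close> is \<open>real^('d option)\<close>, with \<open>None\<close> as the additional zeroth coordinate.\<close>

definition homogenize :: "real^'d \<Rightarrow> real^('d option)" where
  "homogenize x = (\<chi> k. case k of None \<Rightarrow> 1 | Some l \<Rightarrow> x $ l)"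

definition separates :: "real^('d option) \<Rightarrow> (real^'d) set \<Rightarrow> (real^'d) set \<Rightarrow> bool" where
  "separates c U V \<longleftrightarrow>
     norm c = 1 \<and> (\<forall>x\<in>U. c \<bullet> homogenize x < 0) \<and> (\<forall>x\<in>V. c \<bullet> homogenize x > 0)"

lemma inner_homogenize: "c \<bullet> homogenize x = c $ None + (\<Sum>l\<in>UNIV. c $ Some l * x $ l)"
  by (simp add: inner_vec_def homogenize_def UNIV_option_conv sum.reindex)

lemma ex1_separates:
  fixes U V :: "(real^'d) set"
  assumes "open U" "convex U" "U \<noteq> {}" "open V" "convex V" "V \<noteq> {}" "U \<inter> V = {}"
    and dim: "aff_dim (closure U \<inter> closure V) = int CARD('d) - 1"
  shows "\<exists>!c. separates c U V"
proof -
  have ex: "\<exists>c. separates c U V"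
  proof -
    obtain a b where ab: "a \<noteq> 0" "\<forall>x\<in>U. a \<bullet> x \<le> b" "\<forall>x\<in>V. a \<bullet> x \<ge> b"
      using separating_hyperplane_sets[of U V] assms by blast
    have "U \<subseteq> interior {x. a \<bullet> x \<le> b}"
      using ab(2) \<open>open U\<close> by (intro interior_maximal) auto
    moreover have "V \<subseteq> interior {x. a \<bullet> x \<ge> b}"
      using ab(3) \<open>open V\<close> by (intro interior_maximal) auto
    ultimately have strict: "\<forall>x\<in>U. a \<bullet> x < b" "\<forall>x\<in>V. a \<bullet> x > b"
      using ab(1) by auto
    define c :: "real^('d option)" where "c = (\<chi> k. case k of None \<Rightarrow> - b | Some l \<Rightarrow> a $ l)"
    have c: "c \<bullet> homogenize x = a \<bullet> x - b" for x
      unfolding inner_homogenize by (simp add: c_def inner_vec_def)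
    have "c \<noteq> 0"
      using c strict(1) assms(3) by force
    then have "separates (c /\<^sub>R norm c) U V"
      using strict by (auto simp: separates_def c mult_pos_neg)
    then show ?thesis by blast
  qed
  have uniq: "c' = c" if c: "separates c U V" and c': "separates c' U V" for c c'
  proof -
    obtain u where u: "u \<in> U" using assms(3) by blast
    define t where "t = (c' \<bullet> homogenize u) / (c \<bullet> homogenize u)"
    have neg: "c \<bullet> homogenize u < 0" "c' \<bullet> homogenize u < 0"
      using c c' u by (auto simp: separates_def)
    then have t: "t > 0" by (simp add: t_def divide_neg_neg)
    have cont: "continuous_on UNIV (\<lambda>x. w \<bullet> homogenize x)" for w :: "real^('d option)"
      unfolding inner_homogenize by (intro continuous_intros)
    have aff: "affine {x. w \<bullet> homogenize x = 0}" for w :: "real^('d option)"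
    proof -
      have "{x. w \<bullet> homogenize x = 0} = {x. (\<chi> l. w $ Some l) \<bullet> x = - (w $ None)}"
        unfolding inner_homogenize by (auto simp: inner_vec_def)
      then show ?thesis by (simp add: affine_hyperplane)
    qed
    have zero: "w \<bullet> homogenize x = 0"
      if w: "separates w U V" and x: "x \<in> closure U \<inter> closure V" for w x
    proof -
      have "closed {x. w \<bullet> homogenize x \<le> 0}" "closed {x. w \<bullet> homogenize x \<ge> 0}"
        by (intro closed_Collect_le cont continuous_on_const)+
      moreover have "U \<subseteq> {x. w \<bullet> homogenize x \<le> 0}" "V \<subseteq> {x. w \<bullet> homogenize x \<ge> 0}"
        using w by (auto simp: separates_def less_imp_le)
      ultimately have "closure U \<subseteq> {x. w \<bullet> homogenize x \<le> 0}"
        "closure V \<subseteq> {x. w \<bullet> homogenize x \<ge> 0}"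
        by (simp_all add: closure_minimal)
      then show ?thesis using x by fastforce
    qed
    let ?K = "closure U \<inter> closure V"
    have "affine hull ?K \<subseteq> {x. c \<bullet> homogenize x = 0}"
      using zero[OF c] aff[of c] by (intro hull_minimal) auto
    then have "u \<notin> affine hull ?K" using neg by auto
    then have "aff_dim (insert u ?K) = int DIM(real^'d)"
      by (simp add: aff_dim_insert dim)
    then have full: "affine hull (insert u ?K) = UNIV"
      using aff_dim_eq_full by blast
    define w where "w = c' - t *\<^sub>R c"
    have "w \<bullet> homogenize u = 0"
      using neg by (simp add: w_def inner_diff_left t_def)
    moreover have "w \<bullet> homogenize x = 0" if "x \<in> ?K" for x
      using zero[OF c that] zero[OF c' that] by (simp add: w_def inner_diff_left)
    ultimately have "affine hull (insert u ?K) \<subseteq> {x. w \<bullet> homogenize x = 0}"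
      using aff[of w] by (intro hull_minimal) auto
    then have w0: "w \<bullet> homogenize x = 0" for x using full by auto
    have none: "w $ None = 0" using w0[of 0] by (simp add: inner_homogenize)
    have "w $ Some l = 0" for l
      using w0[of "axis l 1"] none by (simp add: inner_homogenize axis_def if_distrib cong: if_cong)
    then have "w = 0" using none by (metis option.exhaust vec_eq_iff zero_index)
    then have eq: "c' = t *\<^sub>R c" by (simp add: w_def)
    moreover have "norm c = 1" "norm c' = 1" using c c' by (auto simp: separates_def)
    ultimately have "t = 1" using t by simp
    then show ?thesis using eq by simp
  qed
  show ?thesis using ex uniq by blast
qed

text \<open>Well-defined for adjacent regions, by \<open>ex1_separates\<close>.\<close>

definition sep_vec :: "(nat \<Rightarrow> (real^'d) set) \<Rightarrow> nat \<Rightarrow> nat \<Rightarrow> real^('d option)" where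
  "sep_vec P i j = (THE c. separates c (P i) (P j))"

text \<open>For an edge \<open>e = {i, j}\<close> with \<open>i < j\<close> we have \<open>Min e = i\<close> and \<open>Max e = j\<close>.\<close>

definition sep_coords ::
    "nat set set \<Rightarrow> (nat \<Rightarrow> (real^'d) set) \<Rightarrow> (nat set \<times> 'd option \<Rightarrow> real)" where
  "sep_coords A P = (\<lambda>(e, k)\<in>A \<times> UNIV. sep_vec P (Min e) (Max e) $ k)"

text \<open>
  The condition takes the graph \<open>A\<close> and \<open>\<C>\<^sub>A\<close>.  A graph without edges yields no coordinates; by
  convention \<open>\<C>\<^sub>A\<close> is then merely regarded as a finite set.
\<close>

definition semialgebraically_parameterized ::
    "nat set set \<Rightarrow> (nat \<Rightarrow> (real^'d) set) set \<Rightarrow> bool" where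
  "semialgebraically_parameterized A C \<longleftrightarrow>
     (if A = {} then finite C
      else \<exists>S. semialgebraic (A \<times> UNIV) S \<and> bij_betw (sep_coords A) C S)"

end

theory Submission
  imports Defs
begin

text \<open>
  A generic segment leaving a region \<open>P\<^sub>i\<close> does so through a \<open>(d-1)\<close>-dimensional piece of the boundary,
  hence into a neighbour.  Therefore every region with a neighbour is the intersection of the open
  half-spaces given by the separating vectors of its edges, while a non-empty region without
  neighbours is the whole space; so the vectors determine the partition.

  Conversely, unit vectors arise from a partition with graph \<open>A\<close> if and only if these
  intersections are non-empty and disjoint, their closures cover the space, and \<open>{i, j}\<close> is an edge
  exactly when some point lies in the closures of the regions \<open>i\<close> and \<open>j\<close> and of no others.  These
  conditions are Boolean combinations of solvability statements for linear systems in
  \<open>x \<in> \<real>\<^sup>d\<close> with coefficients polynomial in the parameters, so Fourier-Motzkin elimination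
  suffices and full Tarski-Seidenberg quantifier elimination is not needed.
\<close>

section \<open>Semialgebraic predicates\<close>

definition monom_val :: "('v \<Rightarrow> real) \<Rightarrow> ('v \<Rightarrow>\<^sub>0 nat) \<Rightarrow> real" where
  "monom_val x m = (\<Prod>v\<in>Poly_Mapping.keys m. x v ^ Poly_Mapping.lookup m v)"

lemma monom_val_superset:
  assumes "finite V" "Poly_Mapping.keys m \<subseteq> V"
  shows "monom_val x m = (\<Prod>v\<in>V. x v ^ Poly_Mapping.lookup m v)"
  unfolding monom_val_def
  by (rule prod.mono_neutral_left) (use assms in \<open>auto simp: in_keys_iff\<close>)

lemma monom_val_add: "monom_val x (m + m') = monom_val x m * monom_val x m'"
proof -
  let ?V = "Poly_Mapping.keys m \<union> Poly_Mapping.keys m'"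
  have "Poly_Mapping.keys (m + m') \<subseteq> ?V" by (rule Poly_Mapping.keys_add)
  then show ?thesis
    by (simp add: monom_val_superset[of ?V] lookup_add power_add prod.distrib)
qed

lemma mpoly_eval_superset:
  assumes "finite M" "Poly_Mapping.keys p \<subseteq> M"
  shows "mpoly_eval p x = (\<Sum>m\<in>M. Poly_Mapping.lookup p m * monom_val x m)"
  unfolding mpoly_eval_def monom_val_def[symmetric]
  by (rule sum.mono_neutral_left) (use assms in \<open>auto simp: in_keys_iff\<close>)

lemma mpoly_eval_add: "mpoly_eval (p + q) x = mpoly_eval p x + mpoly_eval q x"
proof -
  let ?M = "Poly_Mapping.keys p \<union> Poly_Mapping.keys q"
  have "Poly_Mapping.keys (p + q) \<subseteq> ?M" by (rule Poly_Mapping.keys_add)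
  then show ?thesis
    by (simp add: mpoly_eval_superset[of ?M] lookup_add distrib_right sum.distrib)
qed

lemma mpoly_eval_single: "mpoly_eval (Poly_Mapping.single m a) x = a * monom_val x m"
  by (simp add: mpoly_eval_superset[of "{m}"])

definition poly_fun :: "'v set \<Rightarrow> (('v \<Rightarrow> real) \<Rightarrow> real) \<Rightarrow> bool" where
  "poly_fun I f \<longleftrightarrow> (\<exists>p\<in>mpolys_in I. f = mpoly_eval p)"

lemma poly_fun_monom:
  assumes "Poly_Mapping.keys m \<subseteq> I"
  shows "poly_fun I (\<lambda>x. a * monom_val x m)"
  unfolding poly_fun_def
  by (rule bexI[of _ "Poly_Mapping.single m a"])
    (use assms in \<open>auto simp: mpoly_eval_single mpolys_in_def\<close>)

lemma poly_fun_const: "poly_fun I (\<lambda>x. a)"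
  using poly_fun_monom[of 0 I a] by (simp add: monom_val_def)

lemma poly_fun_var: "v \<in> I \<Longrightarrow> poly_fun I (\<lambda>x. x v)"
  using poly_fun_monom[of "Poly_Mapping.single v 1" I 1] by (simp add: monom_val_def)

lemma poly_fun_add:
  assumes "poly_fun I f" "poly_fun I g"
  shows "poly_fun I (\<lambda>x. f x + g x)"
proof -
  obtain p q where pq: "p \<in> mpolys_in I" "q \<in> mpolys_in I" "f = mpoly_eval p" "g = mpoly_eval q"
    using assms by (auto simp: poly_fun_def)
  then have "p + q \<in> mpolys_in I"
    using Poly_Mapping.keys_add[of p q] by (fastforce simp: mpolys_in_def)
  then show ?thesis
    unfolding poly_fun_def pq by (intro bexI[of _ "p + q"]) (auto simp: mpoly_eval_add)
qed

lemma poly_fun_sum: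
  assumes "\<And>k. k \<in> K \<Longrightarrow> poly_fun I (f k)"
  shows "poly_fun I (\<lambda>x. \<Sum>k\<in>K. f k x)"
proof (cases "finite K")
  case True
  then show ?thesis
    using assms by (induction K) (auto intro: poly_fun_const poly_fun_add)
qed (simp add: poly_fun_const)

lemma poly_fun_mult:
  assumes "poly_fun I f" "poly_fun I g"
  shows "poly_fun I (\<lambda>x. f x * g x)"
proof -
  obtain p q where pq: "p \<in> mpolys_in I" "q \<in> mpolys_in I" "f = mpoly_eval p" "g = mpoly_eval q"
    using assms by (auto simp: poly_fun_def)
  have "(\<lambda>x. f x * g x) = (\<lambda>x. \<Sum>m\<in>Poly_Mapping.keys p. \<Sum>m'\<in>Poly_Mapping.keys q.
      (Poly_Mapping.lookup p m * Poly_Mapping.lookup q m') * monom_val x (m + m'))"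
    by (simp add: pq mpoly_eval_def monom_val_def[symmetric] monom_val_add sum_product mult_ac)
  moreover have "poly_fun I \<dots>"
    using pq Poly_Mapping.keys_add
    by (intro poly_fun_sum poly_fun_monom) (fastforce simp: mpolys_in_def)
  ultimately show ?thesis by simp
qed

lemma poly_fun_diff:
  assumes "poly_fun I f" "poly_fun I g"
  shows "poly_fun I (\<lambda>x. f x - g x)"
  using poly_fun_add[OF assms(1) poly_fun_mult[OF poly_fun_const[of I "-1"] assms(2)]] by simp

lemma poly_fun_uminus: "poly_fun I f \<Longrightarrow> poly_fun I (\<lambda>x. - f x)"
  using poly_fun_diff[OF poly_fun_const[of I 0]] by simp

definition semialg_pred :: "'v set \<Rightarrow> (('v \<Rightarrow> real) \<Rightarrow> bool) \<Rightarrow> bool" where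
  "semialg_pred I \<Phi> \<longleftrightarrow> semialgebraic I {x \<in> I \<rightarrow>\<^sub>E UNIV. \<Phi> x}"

lemma semialg_pred_cong:
  assumes "semialg_pred I \<Phi>" "\<And>x. x \<in> I \<rightarrow>\<^sub>E UNIV \<Longrightarrow> \<Phi> x = \<Psi> x"
  shows "semialg_pred I \<Psi>"
proof -
  have "{x \<in> I \<rightarrow>\<^sub>E UNIV. \<Phi> x} = {x \<in> I \<rightarrow>\<^sub>E UNIV. \<Psi> x}" using assms(2) by auto
  then show ?thesis using assms(1) by (simp add: semialg_pred_def)
qed

lemma basic_semialgebraic_imp: "basic_semialgebraic I S \<Longrightarrow> semialgebraic I S"
  unfolding semialgebraic_def by (intro exI[of _ "{S}"]) auto

lemma semialg_pred_pos:
  assumes "poly_fun I f" shows "semialg_pred I (\<lambda>x. f x > 0)"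
proof -
  obtain p where "p \<in> mpolys_in I" "f = mpoly_eval p" using assms by (auto simp: poly_fun_def)
  then have "basic_semialgebraic I {x \<in> I \<rightarrow>\<^sub>E UNIV. f x > 0}"
    unfolding basic_semialgebraic_def by (intro exI[of _ "{}"] exI[of _ "{p}"]) auto
  then show ?thesis by (simp add: semialg_pred_def basic_semialgebraic_imp)
qed

lemma semialg_pred_zero:
  assumes "poly_fun I f" shows "semialg_pred I (\<lambda>x. f x = 0)"
proof -
  obtain p where "p \<in> mpolys_in I" "f = mpoly_eval p" using assms by (auto simp: poly_fun_def)
  then have "basic_semialgebraic I {x \<in> I \<rightarrow>\<^sub>E UNIV. f x = 0}"
    unfolding basic_semialgebraic_def by (intro exI[of _ "{p}"] exI[of _ "{}"]) auto
  then show ?thesis by (simp add: semialg_pred_def basic_semialgebraic_imp)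
qed

lemma semialgebraic_Un:
  assumes "semialgebraic I S" "semialgebraic I T" shows "semialgebraic I (S \<union> T)"
proof -
  obtain \<S> \<T> where "finite \<S>" "\<forall>T\<in>\<S>. basic_semialgebraic I T" "S = \<Union>\<S>"
     "finite \<T>" "\<forall>T\<in>\<T>. basic_semialgebraic I T" "T = \<Union>\<T>"
    using assms unfolding semialgebraic_def by blast
  then show ?thesis
    unfolding semialgebraic_def by (intro exI[of _ "\<S> \<union> \<T>"]) auto
qed

lemma basic_semialgebraic_Int:
  assumes "basic_semialgebraic I S" "basic_semialgebraic I T"
  shows "basic_semialgebraic I (S \<inter> T)"
proof -
  obtain F G F' G' where
    "finite F" "F \<subseteq> mpolys_in I" "finite G" "G \<subseteq> mpolys_in I"
    "S = {x \<in> I \<rightarrow>\<^sub>E UNIV. (\<forall>p\<in>F. mpoly_eval p x = 0) \<and> (\<forall>q\<in>G. mpoly_eval q x > 0)}"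
    "finite F'" "F' \<subseteq> mpolys_in I" "finite G'" "G' \<subseteq> mpolys_in I"
    "T = {x \<in> I \<rightarrow>\<^sub>E UNIV. (\<forall>p\<in>F'. mpoly_eval p x = 0) \<and> (\<forall>q\<in>G'. mpoly_eval q x > 0)}"
    using assms unfolding basic_semialgebraic_def by (elim exE conjE) blast
  then show ?thesis
    unfolding basic_semialgebraic_def
    by (intro exI[of _ "F \<union> F'"] exI[of _ "G \<union> G'"]) blast
qed

lemma semialgebraic_Int:
  assumes "semialgebraic I S" "semialgebraic I T" shows "semialgebraic I (S \<inter> T)"
proof -
  obtain \<S> \<T> where *: "finite \<S>" "\<forall>T\<in>\<S>. basic_semialgebraic I T" "S = \<Union>\<S>"
     "finite \<T>" "\<forall>T\<in>\<T>. basic_semialgebraic I T" "T = \<Union>\<T>"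
    using assms unfolding semialgebraic_def by blast
  then show ?thesis
    unfolding semialgebraic_def
    by (intro exI[of _ "(\<lambda>(U, V). U \<inter> V) ` (\<S> \<times> \<T>)"])
      (auto intro: basic_semialgebraic_Int)
qed

lemma semialg_pred_const: "semialg_pred I (\<lambda>x. b)"
  using semialg_pred_zero[OF poly_fun_const[of I "if b then 0 else 1"]]
  by (auto split: if_splits)

lemma semialg_pred_disj:
  assumes "semialg_pred I \<Phi>" "semialg_pred I \<Psi>" shows "semialg_pred I (\<lambda>x. \<Phi> x \<or> \<Psi> x)"
proof -
  have "{x \<in> I \<rightarrow>\<^sub>E UNIV. \<Phi> x \<or> \<Psi> x} = {x \<in> I \<rightarrow>\<^sub>E UNIV. \<Phi> x} \<union> {x \<in> I \<rightarrow>\<^sub>E UNIV. \<Psi> x}"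
    by auto
  then show ?thesis using assms by (simp add: semialg_pred_def semialgebraic_Un)
qed

lemma semialg_pred_conj:
  assumes "semialg_pred I \<Phi>" "semialg_pred I \<Psi>" shows "semialg_pred I (\<lambda>x. \<Phi> x \<and> \<Psi> x)"
proof -
  have "{x \<in> I \<rightarrow>\<^sub>E UNIV. \<Phi> x \<and> \<Psi> x} = {x \<in> I \<rightarrow>\<^sub>E UNIV. \<Phi> x} \<inter> {x \<in> I \<rightarrow>\<^sub>E UNIV. \<Psi> x}"
    by auto
  then show ?thesis using assms by (simp add: semialg_pred_def semialgebraic_Int)
qed

lemma semialg_pred_Ball:
  assumes "finite K" "\<And>k. k \<in> K \<Longrightarrow> semialg_pred I (\<Phi> k)"
  shows "semialg_pred I (\<lambda>x. \<forall>k\<in>K. \<Phi> k x)"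
  using assms by (induction K) (auto intro: semialg_pred_const semialg_pred_conj)

lemma semialg_pred_Bex:
  assumes "finite K" "\<And>k. k \<in> K \<Longrightarrow> semialg_pred I (\<Phi> k)"
  shows "semialg_pred I (\<lambda>x. \<exists>k\<in>K. \<Phi> k x)"
  using assms by (induction K) (auto intro: semialg_pred_const semialg_pred_disj)

lemma semialg_pred_nonneg:
  assumes "poly_fun I f" shows "semialg_pred I (\<lambda>x. f x \<ge> 0)"
  by (rule semialg_pred_cong[OF semialg_pred_disj[OF semialg_pred_pos[OF assms]
          semialg_pred_zero[OF assms]]]) auto

lemma semialg_pred_not:
  assumes "semialg_pred I \<Phi>" shows "semialg_pred I (\<lambda>x. \<not> \<Phi> x)"
proof -
  obtain \<S> where \<S>: "finite \<S>" "\<And>T. T \<in> \<S> \<Longrightarrow> basic_semialgebraic I T"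
      "{x \<in> I \<rightarrow>\<^sub>E UNIV. \<Phi> x} = \<Union>\<S>"
    using assms unfolding semialg_pred_def semialgebraic_def by metis
  have "semialg_pred I (\<lambda>x. x \<notin> T)" if T: "T \<in> \<S>" for T
  proof -
    obtain F G where FG: "finite F" "F \<subseteq> mpolys_in I" "finite G" "G \<subseteq> mpolys_in I"
      "T = {x \<in> I \<rightarrow>\<^sub>E UNIV. (\<forall>p\<in>F. mpoly_eval p x = 0) \<and> (\<forall>q\<in>G. mpoly_eval q x > 0)}"
      using \<S>(2)[OF T] unfolding basic_semialgebraic_def by (elim exE conjE)
    have pf: "poly_fun I (mpoly_eval p)" if "p \<in> F \<union> G" for p
      using FG that by (auto simp: poly_fun_def)
    have "semialg_pred I (\<lambda>x. (\<exists>p\<in>F. mpoly_eval p x > 0 \<or> - mpoly_eval p x > 0) \<or>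
        (\<exists>q\<in>G. - mpoly_eval q x \<ge> 0))"
      using FG(1,3) pf
      by (intro semialg_pred_disj semialg_pred_Bex semialg_pred_pos semialg_pred_nonneg
          poly_fun_uminus) auto
    then show ?thesis
    proof (rule semialg_pred_cong)
      fix x :: "'a \<Rightarrow> real" assume "x \<in> I \<rightarrow>\<^sub>E UNIV"
      then show "((\<exists>p\<in>F. mpoly_eval p x > 0 \<or> - mpoly_eval p x > 0) \<or>
        (\<exists>q\<in>G. - mpoly_eval q x \<ge> 0)) = (x \<notin> T)"
        unfolding FG(5) by (auto simp: not_less linorder_neq_iff)
    qed
  qed
  then have "semialg_pred I (\<lambda>x. \<forall>T\<in>\<S>. x \<notin> T)"
    by (intro semialg_pred_Ball \<S>(1))
  then show ?thesis
    by (rule semialg_pred_cong) (use \<S>(3) in blast)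
qed

lemma semialg_pred_imp:
  assumes "semialg_pred I \<Phi>" "semialg_pred I \<Psi>" shows "semialg_pred I (\<lambda>x. \<Phi> x \<longrightarrow> \<Psi> x)"
  by (rule semialg_pred_cong[OF semialg_pred_disj[OF semialg_pred_not[OF assms(1)] assms(2)]]) auto

lemma semialg_pred_iff:
  assumes "semialg_pred I \<Phi>" "semialg_pred I \<Psi>" shows "semialg_pred I (\<lambda>x. \<Phi> x \<longleftrightarrow> \<Psi> x)"
  by (rule semialg_pred_cong[OF semialg_pred_conj[OF semialg_pred_imp[OF assms]
        semialg_pred_imp[OF assms(2,1)]]]) auto

definition sat :: "bool \<Rightarrow> real \<Rightarrow> bool" where
  "sat s t \<longleftrightarrow> (if s then t > 0 else t \<ge> 0)"

lemma semialg_pred_sat: "poly_fun I f \<Longrightarrow> semialg_pred I (\<lambda>x. sat s (f x))"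
  by (cases s) (simp_all add: sat_def semialg_pred_pos semialg_pred_nonneg)

lemma one_variable_system:
  fixes \<alpha> \<beta> :: "'t \<Rightarrow> real" and s :: "'t \<Rightarrow> bool"
  assumes fin: "finite L"
  shows "(\<exists>y. \<forall>t\<in>L. sat (s t) (\<alpha> t * y + \<beta> t)) \<longleftrightarrow>
     (\<forall>t\<in>L. \<alpha> t = 0 \<longrightarrow> sat (s t) (\<beta> t)) \<and>
     (\<forall>t\<in>L. \<forall>u\<in>L. \<alpha> t > 0 \<longrightarrow> \<alpha> u < 0 \<longrightarrow> sat (s t \<or> s u) (\<alpha> t * \<beta> u - \<alpha> u * \<beta> t))"
    (is "?lhs \<longleftrightarrow> ?rhs")
proof
  assume ?lhs
  then obtain y where y: "\<forall>t\<in>L. sat (s t) (\<alpha> t * y + \<beta> t)" by blast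
  have "sat (s t \<or> s u) (\<alpha> t * \<beta> u - \<alpha> u * \<beta> t)"
    if "t \<in> L" "u \<in> L" "\<alpha> t > 0" "\<alpha> u < 0" for t u
  proof -
    have eq: "\<alpha> t * \<beta> u - \<alpha> u * \<beta> t = \<alpha> t * (\<alpha> u * y + \<beta> u) + (- \<alpha> u) * (\<alpha> t * y + \<beta> t)"
      by (simp add: algebra_simps)
    have "sat (s t) (\<alpha> t * y + \<beta> t)" "sat (s u) (\<alpha> u * y + \<beta> u)" using y that by auto
    moreover have "sat s' y' \<Longrightarrow> x' > 0 \<Longrightarrow> sat s' (x' * y')" for s' and x' y' :: real
      by (auto simp: sat_def)
    moreover have "sat s1 z1 \<Longrightarrow> sat s2 z2 \<Longrightarrow> sat (s1 \<or> s2) (z2 + z1)" for s1 s2 z1 z2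
      by (auto simp: sat_def split: if_splits)
    ultimately show ?thesis
      unfolding eq using that(3,4) by (metis neg_0_less_iff_less)
  qed
  moreover have "sat (s t) (\<beta> t)" if "t \<in> L" "\<alpha> t = 0" for t
    using y that by force
  ultimately show ?rhs by blast
next
  assume R: ?rhs
  define r where "r t = - \<beta> t / \<alpha> t" for t
  define Ps where "Ps = {t\<in>L. \<alpha> t > 0}"
  define Ns where "Ns = {t\<in>L. \<alpha> t < 0}"
  have finPN: "finite Ps" "finite Ns" using fin by (auto simp: Ps_def Ns_def)
  have le: "sat (s t \<or> s u) (r u - r t)" if "t \<in> Ps" "u \<in> Ns" for t u
  proof -
    have "sat (s t \<or> s u) (\<alpha> t * \<beta> u - \<alpha> u * \<beta> t)" "\<alpha> t > 0" "\<alpha> u < 0"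
      using R that by (auto simp: Ps_def Ns_def)
    moreover from this have "\<alpha> t * \<alpha> u < 0" by (simp add: mult_pos_neg)
    moreover have "r u - r t = (\<alpha> t * \<beta> u - \<alpha> u * \<beta> t) / (- (\<alpha> t * \<alpha> u))"
      using calculation by (simp add: r_def field_simps)
    ultimately show ?thesis
      by (simp only: sat_def neg_0_less_iff_less zero_less_divide_iff zero_le_divide_iff)
        (auto split: if_splits)
  qed
  have ex: "\<exists>y. (\<forall>t\<in>Ps. sat (s t) (y - r t)) \<and> (\<forall>u\<in>Ns. sat (s u) (r u - y))"
  proof (cases "Ps = {} \<or> Ns = {}")
    case True
    then show ?thesis
    proof
      assume "Ps = {}"
      obtain B where B: "\<forall>b\<in>r ` Ns. B \<le> b" using finPN bdd_below_finite[of "r ` Ns"]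
        by (auto simp: bdd_below_def)
      then have "\<forall>u\<in>Ns. B - 1 < r u" by force
      then show ?thesis using \<open>Ps = {}\<close> by (intro exI[of _ "B - 1"]) (auto simp: sat_def less_imp_le)
    next
      assume "Ns = {}"
      obtain B where B: "\<forall>b\<in>r ` Ps. b \<le> B" using finPN bdd_above_finite[of "r ` Ps"]
        by (auto simp: bdd_above_def)
      then have "\<forall>u\<in>Ps. B + 1 > r u" by force
      then show ?thesis using \<open>Ns = {}\<close> by (intro exI[of _ "B + 1"]) (auto simp: sat_def less_imp_le)
    qed
  next
    case False
    define l where "l = Max (r ` Ps)"
    define h where "h = Min (r ` Ns)"
    have l: "l \<in> r ` Ps" "\<forall>t\<in>Ps. r t \<le> l" using False finPN by (auto simp: l_def)
    have h: "h \<in> r ` Ns" "\<forall>t\<in>Ns. h \<le> r t" using False finPN by (auto simp: h_def)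
    obtain t0 u0 where tu: "t0 \<in> Ps" "u0 \<in> Ns" "l = r t0" "h = r u0" using l h by auto
    have "l \<le> h" using le[OF tu(1,2)] tu by (auto simp: sat_def split: if_splits)
    show ?thesis
    proof (intro exI[of _ "(l + h) / 2"] conjI ballI)
      fix t assume t: "t \<in> Ps"
      show "sat (s t) ((l + h) / 2 - r t)"
        using l(2) t \<open>l \<le> h\<close> le[OF t tu(2)] tu(4)
        by (cases "s t") (force simp: sat_def)+
    next
      fix t assume t: "t \<in> Ns"
      show "sat (s t) (r t - (l + h) / 2)"
        using h(2) t \<open>l \<le> h\<close> le[OF tu(1) t] tu(3)
        by (cases "s t") (force simp: sat_def)+
    qed
  qed
  then obtain y where y: "\<forall>t\<in>Ps. sat (s t) (y - r t)" "\<forall>u\<in>Ns. sat (s u) (r u - y)" by blast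
  have "sat (s t) (\<alpha> t * y + \<beta> t)" if "t \<in> L" for t
  proof -
    consider "\<alpha> t = 0" | "\<alpha> t > 0" | "\<alpha> t < 0" by linarith
    then show ?thesis
    proof cases
      case 1 then show ?thesis using R that by auto
    next
      case 2
      then have "sat (s t) (y - r t)" using y that by (auto simp: Ps_def)
      then show ?thesis using 2 by (auto simp: sat_def r_def field_simps split: if_splits)
    next
      case 3
      then have "sat (s t) (r t - y)" using y that by (auto simp: Ns_def)
      then show ?thesis using 3 by (auto simp: sat_def r_def field_simps split: if_splits)
    qed
  qed
  then show ?lhs by blast
qed

section \<open>Linear systems with polynomial coefficients\<close>

text \<open>Parametric Fourier-Motzkin elimination.  A constraint \<open>(s, b, a)\<close> stands for
  \<open>b + \<Sum>\<^sub>k a\<^sub>k x\<^sub>k > 0\<close> or \<open>\<ge> 0\<close>, according to \<open>s\<close>; the signs of the coefficients of the eliminated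
  variable depend on the parameter \<open>c\<close>, hence the case distinction over \<open>Z\<close>, \<open>U\<close> and \<open>V\<close>.\<close>

lemma semialg_pred_linear_system_triples:
  fixes L :: "(bool \<times> (('v \<Rightarrow> real) \<Rightarrow> real) \<times> ('k \<Rightarrow> ('v \<Rightarrow> real) \<Rightarrow> real)) set"
  assumes "finite K" "finite L"
    "\<And>s b a. (s, b, a) \<in> L \<Longrightarrow> poly_fun I b"
    "\<And>s b a k. (s, b, a) \<in> L \<Longrightarrow> poly_fun I (a k)"
  shows "semialg_pred I (\<lambda>c. \<exists>x. \<forall>(s, b, a)\<in>L. sat s (b c + (\<Sum>k\<in>K. a k c * x k)))"
  using assms
proof (induction K arbitrary: L)
  case empty
  have "semialg_pred I (\<lambda>c. \<forall>t\<in>L. sat (fst t) (fst (snd t) c))"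
    using empty by (intro semialg_pred_Ball semialg_pred_sat) auto
  then show ?case
    by (rule semialg_pred_cong) auto
next
  case (insert v K)
  define S where "S t = fst t" for t :: "bool \<times> (('v \<Rightarrow> real) \<Rightarrow> real) \<times> ('k \<Rightarrow> ('v \<Rightarrow> real) \<Rightarrow> real)"
  define B where "B t = fst (snd t)" for t :: "bool \<times> (('v \<Rightarrow> real) \<Rightarrow> real) \<times> ('k \<Rightarrow> ('v \<Rightarrow> real) \<Rightarrow> real)"
  define C where "C t = snd (snd t)" for t :: "bool \<times> (('v \<Rightarrow> real) \<Rightarrow> real) \<times> ('k \<Rightarrow> ('v \<Rightarrow> real) \<Rightarrow> real)"
  define comb where "comb = (\<lambda>(t, u). (S t \<or> S u, (\<lambda>c. C t v c * B u c - C u v c * B t c),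
      (\<lambda>k c. C t v c * C u k c - C u v c * C t k c)))"
  define L' where "L' Z U V = Z \<union> comb ` (U \<times> V)" for Z U V
  have pB: "poly_fun I (B t)" if "t \<in> L" for t
    using insert.prems(2)[of "fst t" "fst (snd t)" "snd (snd t)"] that by (simp add: B_def)
  have pC: "poly_fun I (C t k)" if "t \<in> L" for t k
    using insert.prems(3)[of "fst t" "fst (snd t)" "snd (snd t)"] that by (simp add: C_def)
  have IH: "semialg_pred I (\<lambda>c. \<exists>x. \<forall>(s, b, a)\<in>L' Z U V. sat s (b c + (\<Sum>k\<in>K. a k c * x k)))"
    if "Z \<subseteq> L" "U \<subseteq> L" "V \<subseteq> L" for Z U V
  proof (rule insert.IH)
    show "finite (L' Z U V)"
      using that insert.prems(1) unfolding L'_def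
      by (intro finite_UnI finite_imageI finite_cartesian_product) (erule finite_subset, assumption)+
    show "poly_fun I b" if "(s, b, a) \<in> L' Z U V" for s b a
      using that \<open>Z \<subseteq> L\<close> \<open>U \<subseteq> L\<close> \<open>V \<subseteq> L\<close> insert.prems(2)
      by (auto simp: L'_def comb_def intro!: poly_fun_diff poly_fun_mult pB pC)
    show "poly_fun I (a k)" if "(s, b, a) \<in> L' Z U V" for s b a k
      using that \<open>Z \<subseteq> L\<close> \<open>U \<subseteq> L\<close> \<open>V \<subseteq> L\<close> insert.prems(3)
      by (auto simp: L'_def comb_def intro!: poly_fun_diff poly_fun_mult pB pC)
  qed
  let ?\<Phi> = "\<lambda>Z U V c. (\<forall>t\<in>L. (t \<in> Z \<longleftrightarrow> C t v c = 0) \<and> (t \<in> U \<longleftrightarrow> C t v c > 0) \<and>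
      (t \<in> V \<longleftrightarrow> - C t v c > 0)) \<and>
      (\<exists>x. \<forall>(s, b, a)\<in>L' Z U V. sat s (b c + (\<Sum>k\<in>K. a k c * x k)))"
  have "semialg_pred I (\<lambda>c. \<exists>Z\<in>Pow L. \<exists>U\<in>Pow L. \<exists>V\<in>Pow L. ?\<Phi> Z U V c)"
    using insert.prems(1)
    by (intro semialg_pred_Bex semialg_pred_conj semialg_pred_Ball semialg_pred_iff
        semialg_pred_const semialg_pred_pos semialg_pred_zero poly_fun_uminus pC IH) auto
  then show ?case
  proof (rule semialg_pred_cong)
    fix c :: "'v \<Rightarrow> real"
    define Z where "Z = {t\<in>L. C t v c = 0}"
    define U where "U = {t\<in>L. C t v c > 0}"
    define V where "V = {t\<in>L. C t v c < 0}"
    have "(\<exists>Z\<in>Pow L. \<exists>U\<in>Pow L. \<exists>V\<in>Pow L. ?\<Phi> Z U V c) \<longleftrightarrow>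
        (\<exists>x. \<forall>(s, b, a)\<in>L' Z U V. sat s (b c + (\<Sum>k\<in>K. a k c * x k)))" (is "?l = ?r")
    proof
      assume ?l
      then obtain Z' U' V' where *: "Z' \<subseteq> L" "U' \<subseteq> L" "V' \<subseteq> L"
          "\<forall>t\<in>L. (t \<in> Z' \<longleftrightarrow> C t v c = 0) \<and> (t \<in> U' \<longleftrightarrow> C t v c > 0) \<and> (t \<in> V' \<longleftrightarrow> - C t v c > 0)"
          "\<exists>x. \<forall>(s, b, a)\<in>L' Z' U' V'. sat s (b c + (\<Sum>k\<in>K. a k c * x k))"
        by (elim bexE conjE) simp
      from *(1-4) have "Z' = Z" "U' = U" "V' = V" unfolding Z_def U_def V_def
        by (simp_all only: neg_0_less_iff_less) blast+
      with *(5) show ?r by simp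
    next
      assume r: ?r
      have "\<forall>t\<in>L. (t \<in> Z \<longleftrightarrow> C t v c = 0) \<and> (t \<in> U \<longleftrightarrow> C t v c > 0) \<and> (t \<in> V \<longleftrightarrow> - C t v c > 0)"
        by (simp add: Z_def U_def V_def)
      with r have "?\<Phi> Z U V c" by (rule conjI[rotated])
      moreover have "Z \<in> Pow L" "U \<in> Pow L" "V \<in> Pow L" by (auto simp: Z_def U_def V_def)
      ultimately show ?l by (intro bexI)
    qed
    also have "\<dots> \<longleftrightarrow> (\<exists>x. \<exists>y. \<forall>t\<in>L. sat (S t) (C t v c * y + (B t c + (\<Sum>k\<in>K. C t k c * x k))))"
    proof (rule arg_cong[of _ _ Ex], rule ext)
      fix x :: "'k \<Rightarrow> real"
      define \<beta> where "\<beta> t = B t c + (\<Sum>k\<in>K. C t k c * x k)" for t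
      have comb: "(\<lambda>(s, b, a). sat s (b c + (\<Sum>k\<in>K. a k c * x k))) (comb (t, u)) \<longleftrightarrow>
          sat (S t \<or> S u) (C t v c * \<beta> u - C u v c * \<beta> t)" for t u
        by (simp add: comb_def \<beta>_def algebra_simps sum_distrib_left sum_subtractf)
      have "(\<forall>(s, b, a)\<in>L' Z U V. sat s (b c + (\<Sum>k\<in>K. a k c * x k))) \<longleftrightarrow>
         (\<forall>t\<in>Z. sat (S t) (\<beta> t)) \<and>
         (\<forall>t\<in>U. \<forall>u\<in>V. (\<lambda>(s, b, a). sat s (b c + (\<Sum>k\<in>K. a k c * x k))) (comb (t, u)))"
        unfolding L'_def by (auto simp: S_def B_def C_def \<beta>_def split_beta)
      also have "\<dots> \<longleftrightarrow> (\<forall>t\<in>L. C t v c = 0 \<longrightarrow> sat (S t) (\<beta> t)) \<and>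
         (\<forall>t\<in>L. \<forall>u\<in>L. C t v c > 0 \<longrightarrow> C u v c < 0 \<longrightarrow>
           sat (S t \<or> S u) (C t v c * \<beta> u - C u v c * \<beta> t))"
        unfolding comb by (auto simp: Z_def U_def V_def)
      also have "\<dots> \<longleftrightarrow> (\<exists>y. \<forall>t\<in>L. sat (S t) (C t v c * y + \<beta> t))"
        by (rule one_variable_system[symmetric, OF insert.prems(1)])
      finally show "(\<forall>(s, b, a)\<in>L' Z U V. sat s (b c + (\<Sum>k\<in>K. a k c * x k))) =
        (\<exists>y. \<forall>t\<in>L. sat (S t) (C t v c * y + (B t c + (\<Sum>k\<in>K. C t k c * x k))))"
        by (simp add: \<beta>_def)
    qed
    also have "\<dots> \<longleftrightarrow> (\<exists>x. \<forall>t\<in>L. sat (S t) (B t c + (\<Sum>k\<in>insert v K. C t k c * x k)))" (is "?l = ?r")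
    proof
      assume ?l
      then obtain x y where xy: "\<forall>t\<in>L. sat (S t) (C t v c * y + (B t c + (\<Sum>k\<in>K. C t k c * x k)))"
        by blast
      have "(\<Sum>k\<in>insert v K. C t k c * (x(v := y)) k) = C t v c * y + (\<Sum>k\<in>K. C t k c * x k)" for t
        using insert.hyps by (auto intro!: sum.cong)
      with xy show ?r by (intro exI[of _ "x(v := y)"]) (simp add: algebra_simps)
    next
      assume ?r
      then obtain x where "\<forall>t\<in>L. sat (S t) (B t c + (\<Sum>k\<in>insert v K. C t k c * x k))" by blast
      then show ?l
        using insert.hyps by (intro exI[of _ x] exI[of _ "x v"]) (simp add: algebra_simps)
    qed
    also have "\<dots> \<longleftrightarrow> (\<exists>x. \<forall>(s, b, a)\<in>L. sat s (b c + (\<Sum>k\<in>insert v K. a k c * x k)))"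
      by (simp add: S_def B_def C_def split_beta)
    finally show "(\<exists>Z\<in>Pow L. \<exists>U\<in>Pow L. \<exists>V\<in>Pow L. ?\<Phi> Z U V c) =
      (\<exists>x. \<forall>(s, b, a)\<in>L. sat s (b c + (\<Sum>k\<in>insert v K. a k c * x k)))" .
  qed
qed

lemma semialg_pred_linear_system:
  fixes b :: "'t \<Rightarrow> ('v \<Rightarrow> real) \<Rightarrow> real" and a :: "'t \<Rightarrow> 'd::finite \<Rightarrow> ('v \<Rightarrow> real) \<Rightarrow> real"
  assumes "finite T" "\<And>t. t \<in> T \<Longrightarrow> poly_fun I (b t)" "\<And>t l. t \<in> T \<Longrightarrow> poly_fun I (a t l)"
  shows "semialg_pred I (\<lambda>c. \<exists>x::real^'d. \<forall>t\<in>T. sat (s t) (b t c + (\<Sum>l\<in>UNIV. a t l c * x $ l)))"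
proof -
  have "semialg_pred I (\<lambda>c. \<exists>x. \<forall>(s, b, a)\<in>(\<lambda>t. (s t, b t, a t)) ` T.
      sat s (b c + (\<Sum>k\<in>UNIV. a k c * x k)))"
    using assms by (intro semialg_pred_linear_system_triples) auto
  then show ?thesis
  proof (rule semialg_pred_cong)
    fix c :: "'v \<Rightarrow> real"
    have "(\<exists>x. \<forall>t\<in>T. sat (s t) (b t c + (\<Sum>k\<in>UNIV. a t k c * x k))) \<longleftrightarrow>
      (\<exists>x::real^'d. \<forall>t\<in>T. sat (s t) (b t c + (\<Sum>l\<in>UNIV. a t l c * x $ l)))" (is "?l = ?r")
    proof
      assume ?l
      then obtain x where "\<forall>t\<in>T. sat (s t) (b t c + (\<Sum>k\<in>UNIV. a t k c * x k))" by blast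
      then show ?r by (intro exI[of _ "\<chi> l. x l"]) simp
    qed blast
    then show "(\<exists>x. \<forall>(s, b, a)\<in>(\<lambda>t. (s t, b t, a t)) ` T. sat s (b c + (\<Sum>k\<in>UNIV. a k c * x k))) \<longleftrightarrow>
      (\<exists>x::real^'d. \<forall>t\<in>T. sat (s t) (b t c + (\<Sum>l\<in>UNIV. a t l c * x $ l)))"
      by simp
  qed
qed

section \<open>Adjacency of regions\<close>

lemma interior_closure_partition:
  fixes P :: "nat \<Rightarrow> (real^'d) set"
  assumes "weak_convex_partition n P" "i \<in> {1..n}"
  shows "interior (closure (P i)) = P i"
  using assms by (simp add: weak_convex_partition_def convex_interior_closure interior_open)

lemma disjoint_closure_partition:
  fixes P :: "nat \<Rightarrow> (real^'d) set"
  assumes "weak_convex_partition n P" "i \<in> {1..n}" "j \<in> {1..n}" "i \<noteq> j"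
  shows "P i \<inter> closure (P j) = {}"
proof -
  have "P i \<inter> P j = {}" "open (P i)"
    using assms by (auto simp: weak_convex_partition_def disjoint_family_on_def)
  then show ?thesis by (simp add: open_Int_closure_eq_empty)
qed

lemma adjacency_graph_iff:
  fixes P :: "nat \<Rightarrow> (real^'d) set"
  shows "{i, j} \<in> adjacency_graph n P \<longleftrightarrow>
    i \<in> {1..n} \<and> j \<in> {1..n} \<and> i \<noteq> j \<and> P i \<noteq> {} \<and> P j \<noteq> {} \<and>
    aff_dim (closure (P i) \<inter> closure (P j)) = int CARD('d) - 1"
  unfolding adjacency_graph_def by (auto simp: doubleton_eq_iff Int_commute)

lemma adjacency_graph_cases:
  assumes "e \<in> adjacency_graph n P"
  obtains i j where "e = {i, j}" "i < j" "i \<in> {1..n}" "j \<in> {1..n}"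
  using assms unfolding adjacency_graph_def
  by (smt (verit) insert_commute linorder_neq_iff mem_Collect_eq)

text \<open>If no facet of \<open>P i\<close> met \<open>Q\<close>, the part of the boundary of \<open>P i\<close> in \<open>Q\<close> would have
  codimension at least 2, and a generic segment in \<open>Q\<close> from \<open>p\<close> would leave \<open>P i\<close> without crossing it.\<close>

lemma exists_adjacent_region:
  fixes P :: "nat \<Rightarrow> (real^'d) set"
  assumes P: "weak_convex_partition n P" and i: "i \<in> {1..n}"
    and Q: "open Q" "convex Q" "p \<in> Q" "p \<in> P i" "\<not> Q \<subseteq> closure (P i)"
  obtains j where "{i, j} \<in> adjacency_graph n P" "closure (P i) \<inter> closure (P j) \<inter> Q \<noteq> {}"
proof -
  have "\<exists>j. {i, j} \<in> adjacency_graph n P \<and> closure (P i) \<inter> closure (P j) \<inter> Q \<noteq> {}"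
  proof (rule ccontr)
    assume no: "\<not> ?thesis"
    define J where "J = {j \<in> {1..n}. j \<noteq> i \<and> closure (P i) \<inter> closure (P j) \<inter> Q \<noteq> {}}"
    define M where "M j = closure (P i) \<inter> closure (P j)" for j
    define N where "N j = affine hull (insert p (M j))" for j
    have opc: "open (P k)" "convex (P k)" if "k \<in> {1..n}" for k
      using P that by (auto simp: weak_convex_partition_def)
    have neg: "negligible (N j)" if "j \<in> J" for j
    proof -
      have j: "j \<in> {1..n}" "j \<noteq> i" "P j \<noteq> {}" "P i \<noteq> {}"
        using that by (auto simp: J_def)
      have int: "interior (M j) = {}"
        using P i j interior_closure_partition[OF P i] interior_closure_partition[OF P j(1)]
        by (auto simp: M_def weak_convex_partition_def disjoint_family_on_def)
      have cM: "convex (M j)"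
        unfolding M_def by (intro convex_Int convex_closure opc i j)
      have "M j \<noteq> {}" using that by (auto simp: J_def M_def)
      have "affine hull M j \<noteq> UNIV"
        using rel_interior_interior[of "M j"] rel_interior_eq_empty[OF cM] int \<open>M j \<noteq> {}\<close> by auto
      then have "aff_dim (M j) \<noteq> int CARD('d)"
        using aff_dim_eq_full[of "M j"] by simp
      moreover have "aff_dim (M j) \<noteq> int CARD('d) - 1"
        using no j i that adjacency_graph_iff[of i j n P] by (auto simp: J_def M_def)
      moreover have "aff_dim (M j) \<le> int CARD('d)"
        using aff_dim_le_DIM[of "M j"] by simp
      ultimately have "aff_dim (insert p (M j)) < int DIM(real^'d)"
        by (simp add: aff_dim_insert)
      then have "interior (N j) = {}"
        unfolding N_def by (intro low_dim_interior) simp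
      then show ?thesis
        unfolding N_def by (simp add: negligible_convex_interior affine_imp_convex)
    qed
    have "finite J" by (simp add: J_def)
    with neg have "negligible (\<Union>j\<in>J. N j)" by auto
    moreover have "\<not> negligible (Q - closure (P i))"
      using Q by (intro open_not_negligible open_Diff) auto
    ultimately obtain y where y: "y \<in> Q" "y \<notin> closure (P i)" "\<And>j. j \<in> J \<Longrightarrow> y \<notin> N j"
      using negligible_subset[of "\<Union>j\<in>J. N j" "Q - closure (P i)"] by blast
    have "closed_segment p y \<inter> frontier (closure (P i)) \<noteq> {}"
      by (rule connected_Int_frontier) (use y Q closure_subset in auto)
    then obtain z where z: "z \<in> closed_segment p y" "z \<in> frontier (closure (P i))" by blast
    have zQ: "z \<in> Q" using z(1) Q y(1) closed_segment_subset by blast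
    have zi: "z \<in> closure (P i)" using z(2) by (simp add: frontier_def)
    have "z \<noteq> p"
      using z(2) Q interior_closure_partition[OF P i] by (auto simp: frontier_def)
    have "- closure (P i) \<subseteq> (\<Union>j\<in>{1..n} - {i}. closure (P j))"
      using P by (auto simp: weak_convex_partition_def)
    then have "closure (- closure (P i)) \<subseteq> (\<Union>j\<in>{1..n} - {i}. closure (P j))"
      by (rule closure_minimal) auto
    moreover have "z \<in> closure (- closure (P i))"
      using z(2) by (simp add: frontier_closures)
    ultimately obtain j where j: "j \<in> {1..n}" "j \<noteq> i" "z \<in> closure (P j)" by blast
    then have "j \<in> J" using zi zQ by (auto simp: J_def)
    have "z \<in> N j" "p \<in> N j"
      using zi j unfolding N_def M_def by (auto intro: hull_inc)
    obtain u where u: "z = (1 - u) *\<^sub>R p + u *\<^sub>R y" using z(1) by (auto simp: in_segment)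
    have "u \<noteq> 0" using u \<open>z \<noteq> p\<close> by auto
    have yeq: "y = (1 - 1 / u) *\<^sub>R p + (1 / u) *\<^sub>R z"
    proof -
      have "(1 / u) *\<^sub>R z = (1 / u - 1) *\<^sub>R p + y"
        using \<open>u \<noteq> 0\<close> by (simp add: u scaleR_right_distrib diff_divide_distrib)
      then show ?thesis by (simp add: scaleR_left_diff_distrib)
    qed
    have "affine (N j)" by (simp add: N_def)
    then have "y \<in> N j"
      using mem_affine[of "N j" p z "1 - 1 / u" "1 / u"] \<open>z \<in> N j\<close> \<open>p \<in> N j\<close> yeq by simp
    then show False using y(3) \<open>j \<in> J\<close> by blast
  qed
  then show ?thesis using that by blast
qed

lemma isolated_region_eq_UNIV:
  fixes P :: "nat \<Rightarrow> (real^'d) set"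
  assumes P: "weak_convex_partition n P" and i: "i \<in> {1..n}" "P i \<noteq> {}"
    and iso: "i \<notin> \<Union>(adjacency_graph n P)"
  shows "P i = UNIV"
proof -
  obtain p where "p \<in> P i" using i by blast
  then have "UNIV \<subseteq> closure (P i)"
    using exists_adjacent_region[OF P i(1), of UNIV p] iso by blast
  then show ?thesis
    using interior_closure_partition[OF P i(1)] by (simp add: top.extremum_unique)
qed

lemma other_region_empty:
  assumes "weak_convex_partition n P" "P i = UNIV" "i \<in> {1..n}" "k \<in> {1..n}" "k \<noteq> i"
  shows "P k = {}"
proof -
  have "P i \<inter> P k = {}"
    using assms unfolding weak_convex_partition_def disjoint_family_on_def by metis
  then show ?thesis using assms(2) by simp
qed

lemma segment_to_facet_in_closure:
  fixes F K :: "(real^'d) set"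
  assumes F: "affine hull F = {x. a \<bullet> x = b}" "x \<in> rel_interior F" "F \<subseteq> K" "convex K" "p \<in> K"
    and p: "a \<bullet> p < b"
  shows "\<forall>\<^sub>F z in nhds x. a \<bullet> z \<le> b \<longrightarrow> z \<in> K"
proof -
  define h where "h z = p + ((b - a \<bullet> p) / (a \<bullet> z - a \<bullet> p)) *\<^sub>R (z - p)" for z
  have "x \<in> F" using F(2) rel_interior_subset by blast
  then have "x \<in> affine hull F" by (rule hull_inc)
  then have ax: "a \<bullet> x = b" using F(1) by simp
  obtain e where e: "e > 0" "ball x e \<inter> affine hull F \<subseteq> F"
    using F(2) by (auto simp: mem_rel_interior_ball)
  have "isCont h x"
    unfolding h_def using ax p by (intro continuous_intros) auto
  moreover have "h x = x" using ax p by (simp add: h_def)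
  ultimately have "\<forall>\<^sub>F z in nhds x. h z \<in> ball x e"
    using e(1) unfolding continuous_at_open eventually_nhds
    by (metis open_ball centre_in_ball)
  moreover have "isCont (\<lambda>z. a \<bullet> z) x" by (intro continuous_intros)
  then have "\<forall>\<^sub>F z in nhds x. a \<bullet> z \<in> {a \<bullet> p<..}"
    unfolding continuous_at_open eventually_nhds
    by (metis open_greaterThan greaterThan_iff ax p)
  ultimately show ?thesis
  proof eventually_elim
    case (elim z)
    show ?case
    proof
      assume le: "a \<bullet> z \<le> b"
      have gt: "a \<bullet> z > a \<bullet> p" using elim by simp
      have "a \<bullet> h z = b"
        using gt by (simp add: h_def inner_add_right inner_diff_right)
      then have "h z \<in> F" using e(2) elim F(1) by blast
      then have "h z \<in> K" using F(3) by blast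
      define t where "t = (a \<bullet> z - a \<bullet> p) / (b - a \<bullet> p)"
      have t: "0 \<le> t" "t \<le> 1" using gt le p by (auto simp: t_def)
      have "z = (1 - t) *\<^sub>R p + t *\<^sub>R h z"
      proof -
        have "t * ((b - a \<bullet> p) / (a \<bullet> z - a \<bullet> p)) = 1" using gt p by (simp add: t_def)
        then have "t *\<^sub>R h z = t *\<^sub>R p + (z - p)"
          unfolding h_def scaleR_right_distrib scaleR_scaleR by (simp only: scaleR_one)
        then show ?thesis by (simp add: scaleR_left_diff_distrib)
      qed
      then show "z \<in> K"
        using convexD[OF F(4,5) \<open>h z \<in> K\<close>, of "1 - t" t] t by simp
    qed
  qed
qed

lemma adjacent_iff_point:
  fixes P :: "nat \<Rightarrow> (real^'d) set"
  assumes P: "weak_convex_partition n P" and ij: "i \<in> {1..n}" "j \<in> {1..n}" "i \<noteq> j"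
    and ne: "P i \<noteq> {}" "P j \<noteq> {}"
  shows "{i, j} \<in> adjacency_graph n P \<longleftrightarrow>
    (\<exists>x. x \<in> closure (P i) \<and> x \<in> closure (P j) \<and> (\<forall>k\<in>{1..n} - {i, j}. x \<notin> closure (P k)))"
    (is "?l \<longleftrightarrow> ?r")
proof
  assume ?r
  then obtain x where x: "x \<in> closure (P i)" "x \<in> closure (P j)"
    "\<forall>k\<in>{1..n} - {i, j}. x \<notin> closure (P k)" by blast
  have "open (- (\<Union>k\<in>{1..n} - {i, j}. closure (P k)))" by (intro open_Compl closed_UN) auto
  then obtain e where e: "e > 0" "ball x e \<subseteq> - (\<Union>k\<in>{1..n} - {i, j}. closure (P k))"
    using x(3) open_contains_ball_eq by (metis (no_types, lifting) ComplI UN_E)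
  have meet: "ball x e \<inter> P i \<noteq> {}" "ball x e \<inter> P j \<noteq> {}"
    using x e(1) by (metis centre_in_ball disjoint_iff open_Int_closure_eq_empty open_ball)+
  then have "\<not> ball x e \<subseteq> closure (P i)"
    using disjoint_closure_partition[OF P ij(2,1)] ij(3) by blast
  moreover obtain p where "p \<in> ball x e" "p \<in> P i" using meet by blast
  ultimately obtain j' where j': "{i, j'} \<in> adjacency_graph n P"
      "closure (P i) \<inter> closure (P j') \<inter> ball x e \<noteq> {}"
    using exists_adjacent_region[OF P ij(1), of "ball x e" p] by auto
  have "j' \<in> {1..n}" "j' \<noteq> i" using j'(1) by (auto simp: adjacency_graph_iff)
  then have "j' = j" using j'(2) e(2) by blast
  then show ?l using j' by simp
next
  assume ?l
  then have dim: "aff_dim (closure (P i) \<inter> closure (P j)) = int CARD('d) - 1"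
    by (simp add: adjacency_graph_iff)
  define F where "F = closure (P i) \<inter> closure (P j)"
  have opc: "open (P k)" "convex (P k)" if "k \<in> {1..n}" for k
    using P that by (auto simp: weak_convex_partition_def)
  have cF: "convex F" unfolding F_def by (intro convex_Int convex_closure opc ij)
  have "F \<noteq> {}"
  proof
    assume "F = {}"
    then have "int CARD('d) = 0" using dim by (simp add: F_def)
    then show False by simp
  qed
  then obtain x where x: "x \<in> rel_interior F" using rel_interior_eq_empty[OF cF] by blast
  have "P i \<inter> P j = {}"
    using P ij by (auto simp: weak_convex_partition_def disjoint_family_on_def)
  then obtain a b where ab: "a \<noteq> 0" "\<forall>x\<in>P i. a \<bullet> x \<le> b" "\<forall>x\<in>P j. a \<bullet> x \<ge> b"
    using separating_hyperplane_sets[of "P i" "P j"] ne opc ij by blast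
  have "P i \<subseteq> interior {x. a \<bullet> x \<le> b}"
    using ab(2) opc ij by (intro interior_maximal) auto
  moreover have "P j \<subseteq> interior {x. a \<bullet> x \<ge> b}"
    using ab(3) opc ij by (intro interior_maximal) auto
  ultimately have strict: "\<forall>x\<in>P i. a \<bullet> x < b" "\<forall>x\<in>P j. a \<bullet> x > b"
    using ab(1) by auto
  have "closure (P i) \<subseteq> {x. a \<bullet> x \<le> b}" "closure (P j) \<subseteq> {x. a \<bullet> x \<ge> b}"
    using ab by (intro closure_minimal closed_halfspace_le closed_halfspace_ge subsetI CollectI; blast)+
  then have "F \<subseteq> {x. a \<bullet> x = b}" unfolding F_def by fastforce
  then have "affine hull F = {x. a \<bullet> x = b}"
    using dim ab(1) \<open>F \<noteq> {}\<close>
    by (intro affine_dim_equal hull_minimal affine_hyperplane)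
      (auto simp: F_def of_nat_diff Suc_leI)
  moreover obtain p q where pq: "p \<in> P i" "q \<in> P j" using ne by blast
  ultimately have "\<forall>\<^sub>F z in nhds x. a \<bullet> z \<le> b \<longrightarrow> z \<in> closure (P i)"
    using x opc[OF ij(1)] strict closure_subset[THEN subsetD] unfolding F_def
    by (intro segment_to_facet_in_closure[of F a b]) (auto simp: F_def convex_closure)
  moreover have "affine hull F = {x. - a \<bullet> x = - b}"
    using \<open>affine hull F = {x. a \<bullet> x = b}\<close> by simp
  then have "\<forall>\<^sub>F z in nhds x. - a \<bullet> z \<le> - b \<longrightarrow> z \<in> closure (P j)"
    using x opc[OF ij(2)] strict closure_subset[THEN subsetD] pq
    by (intro segment_to_facet_in_closure[of F "- a" "- b"]) (auto simp: F_def convex_closure)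
  ultimately have "\<forall>\<^sub>F z in nhds x. z \<in> closure (P i) \<union> closure (P j)"
    by eventually_elim (use linorder_linear in auto)
  then obtain U where U: "open U" "x \<in> U" "U \<subseteq> closure (P i) \<union> closure (P j)"
    unfolding eventually_nhds by blast
  have "x \<notin> closure (P k)" if k: "k \<in> {1..n} - {i, j}" for k
  proof -
    have "P k \<inter> closure (P i) = {}" "P k \<inter> closure (P j) = {}"
      using k ij disjoint_closure_partition[OF P] by auto
    then have "U \<inter> P k = {}" using U(3) by blast
    then show ?thesis using U by (metis disjoint_iff open_Int_closure_eq_empty)
  qed
  moreover have "x \<in> F" using x rel_interior_subset by blast
  ultimately show ?r unfolding F_def by blast
qed

section \<open>Recovering the partition from the separating vectors\<close>

text \<open>The sign makes the form positive on the region of the endpoint \<open>i\<close> of \<open>e\<close>, whichever endpoint \<open>i\<close> is.\<close>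

definition edge_form ::
    "(nat set \<times> 'd option \<Rightarrow> real) \<Rightarrow> nat \<Rightarrow> nat set \<Rightarrow> real^'d \<Rightarrow> real" where
  "edge_form c i e x = (if i = Min e then - 1 else 1) * ((\<chi> k. c (e, k)) \<bullet> homogenize x)"

definition region :: "nat set set \<Rightarrow> (nat set \<times> 'd option \<Rightarrow> real) \<Rightarrow> nat \<Rightarrow> (real^'d) set" where
  "region A c i = {x. \<forall>e\<in>A. i \<in> e \<longrightarrow> edge_form c i e x > 0}"

definition regions ::
    "nat \<Rightarrow> nat set set \<Rightarrow> (nat set \<times> 'd option \<Rightarrow> real) \<Rightarrow> nat \<Rightarrow> (real^'d) set" where
  "regions n A c = (\<lambda>i\<in>{1..n}. if i \<in> \<Union>A then region A c i else {})"

definition graph_on :: "nat \<Rightarrow> nat set set \<Rightarrow> bool" where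
  "graph_on n A \<longleftrightarrow> (\<forall>e\<in>A. \<exists>i j. e = {i, j} \<and> i < j \<and> i \<in> {1..n} \<and> j \<in> {1..n})"

lemma graph_on_adjacency_graph: "graph_on n (adjacency_graph n P)"
  unfolding graph_on_def by (blast elim: adjacency_graph_cases)

lemma graph_onE:
  assumes "graph_on n A" "e \<in> A"
  obtains i j where "e = {i, j}" "i < j" "i \<in> {1..n}" "j \<in> {1..n}"
  using assms unfolding graph_on_def by blast

lemma graph_on_vertices: "graph_on n A \<Longrightarrow> \<Union>A \<subseteq> {1..n}"
  by (auto elim!: graph_onE)

lemma finite_graph_on: "graph_on n A \<Longrightarrow> finite A"
  by (rule finite_subset[of _ "Pow {1..n}"]) (auto dest!: graph_on_vertices)

lemma edge_form_linear:
  "edge_form c i e x = (if i = Min e then - 1 else 1) * c (e, None) +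
     (\<Sum>l\<in>UNIV. ((if i = Min e then - 1 else 1) * c (e, Some l)) * x $ l)"
  by (simp add: edge_form_def inner_homogenize sum_negf)

lemma edge_form_inner:
  "edge_form c i e x = (\<chi> l. (if i = Min e then - 1 else 1) * c (e, Some l)) \<bullet> x
     + (if i = Min e then - 1 else 1) * c (e, None)"
  unfolding edge_form_linear by (simp add: inner_vec_def)

lemma edge_form_opposite:
  assumes "e = {i, j}" "i \<noteq> j" shows "edge_form c j e x = - edge_form c i e x"
  using assms by (auto simp: edge_form_def min_def)

lemma edge_form_halfspaces:
  "open {x. edge_form c i e x > 0}" "convex {x. edge_form c i e x > 0}"
  "closed {x. edge_form c i e x \<ge> 0}" "closed {x. edge_form c i e x \<le> 0}"
proof -
  obtain w b where *: "edge_form c i e x = w \<bullet> x - b" for x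
    using edge_form_inner[of c i e]
    by (metis add.inverse_inverse diff_minus_eq_add)
  show "open {x. edge_form c i e x > 0}" "convex {x. edge_form c i e x > 0}"
    "closed {x. edge_form c i e x \<ge> 0}" "closed {x. edge_form c i e x \<le> 0}"
    using open_halfspace_gt[of b w] convex_halfspace_gt[of b w] closed_halfspace_ge[of b w]
      closed_halfspace_le[of w b] by (simp_all add: *)
qed

lemma open_region:
  assumes "finite A" shows "open (region A c i)"
proof -
  have "region A c i = (\<Inter>e\<in>{e\<in>A. i \<in> e}. {x. edge_form c i e x > 0})"
    by (auto simp: region_def)
  then show ?thesis using assms by (auto intro!: open_INT edge_form_halfspaces)
qed

lemma convex_region: "convex (region A c i)"
proof -
  have "region A c i = (\<Inter>e\<in>{e\<in>A. i \<in> e}. {x. edge_form c i e x > 0})"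
    by (auto simp: region_def)
  then show ?thesis by (auto intro!: convex_INT edge_form_halfspaces)
qed

lemma closure_region:
  assumes "region A c i \<noteq> {}"
  shows "closure (region A c i) = {x. \<forall>e\<in>A. i \<in> e \<longrightarrow> edge_form c i e x \<ge> 0}" (is "_ = ?R")
proof
  have "?R = (\<Inter>e\<in>{e\<in>A. i \<in> e}. {x. edge_form c i e x \<ge> 0})" by auto
  then have "closed ?R" by (auto intro!: closed_INT edge_form_halfspaces)
  then show "closure (region A c i) \<subseteq> ?R"
    by (intro closure_minimal) (auto simp: region_def less_imp_le)
  obtain p where p: "p \<in> region A c i" using assms by blast
  show "?R \<subseteq> closure (region A c i)"
  proof
    fix x assume x: "x \<in> ?R"
    have "open_segment p x \<subseteq> region A c i"
    proof
      fix z assume "z \<in> open_segment p x"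
      then obtain u where u: "z = (1 - u) *\<^sub>R p + u *\<^sub>R x" "0 < u" "u < 1"
        by (auto simp: in_segment)
      have "edge_form c i e z = (1 - u) * edge_form c i e p + u * edge_form c i e x" for e
        unfolding u(1) edge_form_inner by (simp add: inner_add_right algebra_simps)
      then show "z \<in> region A c i"
        using u p x by (auto simp: region_def intro!: add_pos_nonneg)
    qed
    then have "closure (open_segment p x) \<subseteq> closure (region A c i)" by (rule closure_mono)
    then show "x \<in> closure (region A c i)"
      using p closure_subset[of "region A c i"] by (cases "p = x") auto
  qed
qed

lemma separates_iff_edge_form:
  assumes "i < j"
  shows "separates (\<chi> k. c ({i, j}, k)) U V \<longleftrightarrow> norm (\<chi> k. c ({i, j}, k)) = 1 \<and>
    (\<forall>x\<in>U. edge_form c i {i, j} x > 0) \<and> (\<forall>x\<in>V. edge_form c j {i, j} x > 0)"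
  using assms by (auto simp: separates_def edge_form_def min_def)

lemma adjacency_graph_vertex_nonempty: "i \<in> \<Union>(adjacency_graph n P) \<Longrightarrow> P i \<noteq> {}"
  by (auto simp: adjacency_graph_def)

lemma sep_coords_vec:
  assumes "e \<in> A" shows "(\<chi> k. sep_coords A P (e, k)) = sep_vec P (Min e) (Max e)"
  using assms by (simp add: sep_coords_def vec_eq_iff)

lemma sep_coords_extensional: "sep_coords A P \<in> A \<times> UNIV \<rightarrow>\<^sub>E UNIV"
  by (auto simp: sep_coords_def)

lemma partitions_le_eq: "partitions_le n = {P. weak_convex_partition n P}"
  by (auto simp: partitions_le_def proper_partitions_def nonproper_partitions_def)

lemma ex1_separates_adjacent:
  fixes P :: "nat \<Rightarrow> (real^'d) set"
  assumes P: "weak_convex_partition n P" and e: "{i, j} \<in> adjacency_graph n P"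
  shows "\<exists>!c. separates c (P i) (P j)"
proof -
  have ij: "i \<in> {1..n}" "j \<in> {1..n}" "i \<noteq> j" "P i \<noteq> {}" "P j \<noteq> {}"
    "aff_dim (closure (P i) \<inter> closure (P j)) = int CARD('d) - 1"
    using e by (auto simp: adjacency_graph_iff)
  then show ?thesis
    using P by (intro ex1_separates)
      (auto simp: weak_convex_partition_def disjoint_family_on_def)
qed

lemma separates_sep_coords:
  fixes P :: "nat \<Rightarrow> (real^'d) set"
  assumes P: "weak_convex_partition n P" and e: "{i, j} \<in> adjacency_graph n P" and "i < j"
  shows "separates (\<chi> k. sep_coords (adjacency_graph n P) P ({i, j}, k)) (P i) (P j)"
proof -
  have "Min {i, j} = i" "Max {i, j} = j" using \<open>i < j\<close> by auto
  then show ?thesis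
    using theI'[OF ex1_separates_adjacent[OF P e]]
    by (simp add: sep_coords_vec[OF e] sep_vec_def)
qed

lemma edge_form_sep_coords:
  fixes P :: "nat \<Rightarrow> (real^'d) set"
  assumes P: "weak_convex_partition n P" and e: "{i, j} \<in> adjacency_graph n P" and x: "x \<in> P i"
  shows "edge_form (sep_coords (adjacency_graph n P) P) i {i, j} x > 0"
proof -
  have "i \<noteq> j" using e by (auto simp: adjacency_graph_iff)
  then consider "i < j" | "j < i" by linarith
  then show ?thesis
  proof cases
    case 1
    then show ?thesis using separates_sep_coords[OF P e] x by (simp add: separates_iff_edge_form)
  next
    case 2
    then show ?thesis
      using separates_sep_coords[OF P _ 2] e x
      unfolding separates_iff_edge_form[OF 2] insert_commute[of i j] by blast
  qed
qed

lemma regions_sep_coords: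
  fixes P :: "nat \<Rightarrow> (real^'d) set"
  assumes P: "weak_convex_partition n P" and ne: "adjacency_graph n P \<noteq> {}"
  shows "regions n (adjacency_graph n P) (sep_coords (adjacency_graph n P) P) = P"
proof
  fix i
  let ?A = "adjacency_graph n P"
  let ?c = "sep_coords ?A P"
  consider "i \<notin> {1..n}" | "i \<in> {1..n}" "i \<notin> \<Union>?A" | "i \<in> {1..n}" "i \<in> \<Union>?A" by blast
  then show "regions n ?A ?c i = P i"
  proof cases
    case 1
    then show ?thesis using P by (auto simp: regions_def weak_convex_partition_def extensional_def)
  next
    case 2
    have "P i = {}"
    proof (rule ccontr)
      assume "P i \<noteq> {}"
      then have "P i = UNIV" using isolated_region_eq_UNIV[OF P] 2 by blast
      obtain e where "e \<in> ?A" using ne by blast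
      moreover from this obtain k l where "e = {k, l}" by (rule adjacency_graph_cases)
      ultimately have "{k, l} \<in> ?A" by simp
      then have "k \<noteq> i" "k \<in> {1..n}" "P k \<noteq> {}"
        using 2(2) by (blast, simp_all add: adjacency_graph_iff)
      then show False using other_region_empty[OF P \<open>P i = UNIV\<close> 2(1)] by blast
    qed
    then show ?thesis using 2 by (simp add: regions_def)
  next
    case 3
    let ?R = "region ?A ?c i"
    have "P i \<noteq> {}" using 3(2) by (rule adjacency_graph_vertex_nonempty)
    then obtain p where p: "p \<in> P i" by blast
    have sub: "P i \<subseteq> ?R"
    proof
      fix x assume "x \<in> P i"
      have "edge_form ?c i e x > 0" if e: "e \<in> ?A" "i \<in> e" for e
      proof -
        obtain k l where "e = {k, l}" using e(1) by (rule adjacency_graph_cases)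
        then obtain j where "e = {i, j}" using e(2) by (auto simp: insert_commute)
        then show ?thesis using edge_form_sep_coords[OF P _ \<open>x \<in> P i\<close>] e(1) by blast
      qed
      then show "x \<in> ?R" by (simp add: region_def)
    qed
    have open_R: "open ?R" "convex ?R"
      by (rule open_region[OF finite_graph_on[OF graph_on_adjacency_graph]], rule convex_region)
    have "?R \<subseteq> closure (P i)"
    proof (rule ccontr)
      assume "\<not> ?R \<subseteq> closure (P i)"
      then obtain j where j: "{i, j} \<in> ?A" "closure (P i) \<inter> closure (P j) \<inter> ?R \<noteq> {}"
        using exists_adjacent_region[OF P 3(1) open_R _ p] sub p by blast
      then obtain x where x: "x \<in> closure (P j)" "x \<in> ?R" by blast
      have "i \<noteq> j" using j(1) by (auto simp: adjacency_graph_iff)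
      have "P j \<subseteq> {x. edge_form ?c i {i, j} x \<le> 0}"
      proof
        fix y assume "y \<in> P j"
        then have "edge_form ?c j {i, j} y > 0"
          using edge_form_sep_coords[OF P, of j i y] j(1) by (simp add: insert_commute)
        then show "y \<in> {x. edge_form ?c i {i, j} x \<le> 0}"
          using edge_form_opposite[of "{i, j}" i j ?c y] \<open>i \<noteq> j\<close> by simp
      qed
      then have "closure (P j) \<subseteq> {x. edge_form ?c i {i, j} x \<le> 0}"
        by (intro closure_minimal edge_form_halfspaces)
      then have "edge_form ?c i {i, j} x \<le> 0" using x by blast
      moreover have "edge_form ?c i {i, j} x > 0" using x(2) j(1) by (simp add: region_def)
      ultimately show False by simp
    qed
    then have "?R \<subseteq> P i"
      using open_R(1) interior_closure_partition[OF P 3(1)] interior_maximal by blast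
    then show ?thesis using sub 3 by (auto simp: regions_def)
  qed
qed

lemma sep_coords_regions:
  fixes c :: "nat set \<times> 'd::finite option \<Rightarrow> real"
  assumes c: "c \<in> A \<times> UNIV \<rightarrow>\<^sub>E UNIV" "\<forall>e\<in>A. norm (\<chi> k. c (e, k)) = 1"
    and P: "regions n A c \<in> partitions_with_graph n A"
  shows "sep_coords A (regions n A c) = c"
proof
  let ?P = "regions n A c"
  have P': "weak_convex_partition n ?P" "adjacency_graph n ?P = A"
    using P by (auto simp: partitions_with_graph_def partitions_le_eq)
  fix t :: "nat set \<times> 'd option"
  obtain e k where t: "t = (e, k)" by fastforce
  show "sep_coords A ?P t = c t"
  proof (cases "e \<in> A")
    case False
    then show ?thesis using PiE_arb[OF c(1), of "(e, k)"] by (simp add: sep_coords_def t)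
  next
    case True
    then have "e \<in> adjacency_graph n ?P" using P'(2) by simp
    then obtain i j where ij: "e = {i, j}" "i < j" "i \<in> {1..n}" "j \<in> {1..n}"
      by (rule adjacency_graph_cases)
    have "separates (\<chi> k. c (e, k)) (?P i) (?P j)"
      unfolding ij(1) separates_iff_edge_form[OF ij(2)]
      using c(2) True ij by (auto simp: regions_def region_def split: if_splits)
    moreover have "separates (\<chi> k. sep_coords A ?P (e, k)) (?P i) (?P j)"
      using separates_sep_coords[OF P'(1), of i j] P'(2) True ij by simp
    ultimately have "(\<chi> k. sep_coords A ?P (e, k)) = (\<chi> k. c (e, k))"
      using ex1_separates_adjacent[OF P'(1), of i j] P'(2) True ij by blast
    then show ?thesis by (simp add: t vec_eq_iff)
  qed
qed

definition graph_params :: "nat \<Rightarrow> nat set set \<Rightarrow> (nat set \<times> 'd::finite option \<Rightarrow> real) set" where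
  "graph_params n A = {c \<in> A \<times> UNIV \<rightarrow>\<^sub>E UNIV. (\<forall>e\<in>A. norm (\<chi> k. c (e, k)) = 1) \<and>
     (regions n A c :: nat \<Rightarrow> (real^'d) set) \<in> partitions_with_graph n A}"

lemma bij_betw_sep_coords:
  assumes "A \<noteq> {}"
  shows "bij_betw (sep_coords A) (partitions_with_graph n A :: (nat \<Rightarrow> (real^'d) set) set)
    (graph_params n A)"
proof (rule bij_betw_byWitness[where f' = "regions n A"])
  show "\<forall>P\<in>partitions_with_graph n A. regions n A (sep_coords A P) = (P :: nat \<Rightarrow> (real^'d) set)"
    using assms regions_sep_coords by (auto simp: partitions_with_graph_def partitions_le_eq)
  show "\<forall>c\<in>graph_params n A. sep_coords A (regions n A c :: nat \<Rightarrow> (real^'d) set) = c"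
    by (simp add: graph_params_def sep_coords_regions)
  show "sep_coords A ` (partitions_with_graph n A :: (nat \<Rightarrow> (real^'d) set) set)
      \<subseteq> graph_params n A"
  proof
    fix c assume "c \<in> sep_coords A ` (partitions_with_graph n A :: (nat \<Rightarrow> (real^'d) set) set)"
    then obtain P :: "nat \<Rightarrow> (real^'d) set" where
      P: "P \<in> partitions_with_graph n A" "c = sep_coords A P" by blast
    then have wP: "weak_convex_partition n P" "adjacency_graph n P = A"
      by (auto simp: partitions_with_graph_def partitions_le_eq)
    have "norm (\<chi> k. c (e, k)) = 1" if "e \<in> A" for e
    proof -
      have "e \<in> adjacency_graph n P" using that wP(2) by simp
      then obtain i j where "e = {i, j}" "i < j" by (rule adjacency_graph_cases)
      then show ?thesis
        using separates_sep_coords[OF wP(1), of i j] that wP(2) by (simp add: separates_def P(2))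
    qed
    moreover have "regions n A c = P" using regions_sep_coords[OF wP(1)] wP(2) assms P(2) by simp
    ultimately show "c \<in> graph_params n A"
      using P sep_coords_extensional by (simp add: graph_params_def)
  qed
  show "regions n A ` graph_params n A \<subseteq> (partitions_with_graph n A :: (nat \<Rightarrow> (real^'d) set) set)"
    by (auto simp: graph_params_def)
qed

lemma partitions_with_graph_iff:
  fixes c :: "nat set \<times> 'd::finite option \<Rightarrow> real"
  assumes A: "graph_on n A"
  defines "V \<equiv> \<Union>A"
  defines "strict \<equiv> \<lambda>i x. \<forall>e\<in>{e\<in>A. i \<in> e}. edge_form c i e x > 0"
  defines "weak \<equiv> \<lambda>i x. \<forall>e\<in>{e\<in>A. i \<in> e}. edge_form c i e x \<ge> 0"
  defines "beyond \<equiv> \<lambda>i x. \<exists>e\<in>{e\<in>A. i \<in> e}. edge_form c i e x < 0"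
  shows "regions n A c \<in> partitions_with_graph n A \<longleftrightarrow>
    (\<forall>i\<in>V. \<exists>x. strict i x) \<and>
    (\<forall>i\<in>V. \<forall>j\<in>V - {i}. \<not> (\<exists>x. strict i x \<and> strict j x)) \<and>
    \<not> (\<exists>x. \<forall>i\<in>V. beyond i x) \<and>
    (\<forall>i\<in>V. \<forall>j\<in>V - {i}. {i, j} \<in> A \<longleftrightarrow>
      (\<exists>x. weak i x \<and> weak j x \<and> (\<forall>k\<in>V - {i, j}. beyond k x)))"
    (is "_ \<longleftrightarrow> ?a \<and> ?b \<and> ?c \<and> ?d")
proof -
  let ?P = "regions n A c"
  have V: "V \<subseteq> {1..n}" unfolding V_def by (rule graph_on_vertices[OF A])
  have in_P: "x \<in> ?P i \<longleftrightarrow> strict i x" if "i \<in> V" for i x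
    using that V by (auto simp: regions_def region_def strict_def V_def)
  have out_V: "?P i = {}" if "i \<in> {1..n}" "i \<notin> V" for i
    using that by (simp add: regions_def V_def)
  have a: ?a if "adjacency_graph n ?P = A"
  proof
    fix i assume "i \<in> V"
    then have "?P i \<noteq> {}"
      using adjacency_graph_vertex_nonempty[of i n ?P] that by (simp add: V_def)
    then show "\<exists>x. strict i x" using in_P[OF \<open>i \<in> V\<close>] by blast
  qed
  have main: "weak_convex_partition n ?P \<and> adjacency_graph n ?P = A \<longleftrightarrow> ?b \<and> ?c \<and> ?d" if a: ?a
  proof -
    have ne: "?P i \<noteq> {}" if "i \<in> V" for i using a in_P[OF that] that by blast
    have cl: "x \<in> closure (?P i) \<longleftrightarrow> weak i x" if "i \<in> V" for i x
    proof -
      have "?P i = region A c i" using that V by (auto simp: regions_def V_def)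
      then show ?thesis using ne[OF that] by (simp add: closure_region weak_def) blast
    qed
    have out: "beyond i x \<longleftrightarrow> \<not> weak i x" for i x by (auto simp: beyond_def weak_def not_le)
    have "disjoint_family_on ?P {1..n} \<longleftrightarrow> ?b"
    proof
      assume dj: "disjoint_family_on ?P {1..n}"
      show ?b
      proof (intro ballI notI)
        fix i j assume ij: "i \<in> V" "j \<in> V - {i}" "\<exists>x. strict i x \<and> strict j x"
        then have "?P i \<inter> ?P j = {}"
          using dj V by (intro disjoint_family_onD[OF dj]) auto
        then show False using ij in_P by blast
      qed
    next
      assume b: ?b
      show "disjoint_family_on ?P {1..n}"
        unfolding disjoint_family_on_def
      proof (intro ballI impI)
        fix i j assume ij: "i \<in> {1..n}" "j \<in> {1..n}" "i \<noteq> j"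
        show "?P i \<inter> ?P j = {}"
        proof (cases "i \<in> V \<and> j \<in> V")
          case True
          then show ?thesis using b ij in_P by blast
        next
          case False
          then show ?thesis using out_V ij by auto
        qed
      qed
    qed
    moreover have "(\<Union>i\<in>{1..n}. closure (?P i)) = UNIV \<longleftrightarrow> ?c"
    proof -
      have "(\<Union>i\<in>{1..n}. closure (?P i)) = (\<Union>i\<in>V. closure (?P i))"
        using V out_V by fastforce
      also have "\<dots> = UNIV \<longleftrightarrow> (\<forall>x. \<exists>i\<in>V. weak i x)" using cl by blast
      finally show ?thesis by (simp add: out)
    qed
    moreover have "?P \<in> extensional {1..n}" by (simp add: regions_def)
    moreover have "\<forall>i\<in>{1..n}. open (?P i) \<and> convex (?P i)"
      using finite_graph_on[OF A] by (simp add: regions_def open_region convex_region)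
    ultimately have w: "weak_convex_partition n ?P \<longleftrightarrow> ?b \<and> ?c"
      by (simp add: weak_convex_partition_def)
    have "adjacency_graph n ?P = A \<longleftrightarrow> ?d" if wP: "weak_convex_partition n ?P"
    proof -
      have adj: "{i, j} \<in> adjacency_graph n ?P \<longleftrightarrow>
          (\<exists>x. weak i x \<and> weak j x \<and> (\<forall>k\<in>V - {i, j}. beyond k x))"
        if ij: "i \<in> V" "j \<in> V - {i}" for i j
      proof -
        have "(\<forall>k\<in>{1..n} - {i, j}. x \<notin> closure (?P k)) \<longleftrightarrow> (\<forall>k\<in>V - {i, j}. beyond k x)" for x
        proof -
          have "(\<forall>k\<in>{1..n} - {i, j}. x \<notin> closure (?P k)) \<longleftrightarrow> (\<forall>k\<in>V - {i, j}. x \<notin> closure (?P k))"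
          proof -
            have "x \<notin> closure (?P k)" if "k \<in> {1..n}" "k \<notin> V" for k
              using out_V[OF that] by simp
            then show ?thesis using V by blast
          qed
          then show ?thesis by (simp add: cl out)
        qed
        then show ?thesis
          using adjacent_iff_point[OF wP, of i j] ij V ne[of i] ne[of j] cl[of i] cl[of j]
          by (simp add: subset_iff)
      qed
      show ?thesis
      proof
        assume "adjacency_graph n ?P = A"
        then show ?d using adj by simp
      next
        assume d: ?d
        then have same: "{i, j} \<in> adjacency_graph n ?P \<longleftrightarrow> {i, j} \<in> A"
          if "i \<in> V" "j \<in> V - {i}" for i j
          using adj[OF that] that by blast
        show "adjacency_graph n ?P = A"
        proof (intro equalityI subsetI)
          fix e assume e: "e \<in> adjacency_graph n ?P"
          then obtain i j where ij: "e = {i, j}" "i < j" "i \<in> {1..n}" "j \<in> {1..n}"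
            by (rule adjacency_graph_cases)
          have "?P i \<noteq> {}" "?P j \<noteq> {}" using e ij by (auto simp: adjacency_graph_iff)
          then have "i \<in> V" "j \<in> V - {i}" using ij out_V by auto
          then show "e \<in> A" using e same ij by blast
        next
          fix e assume e: "e \<in> A"
          then obtain i j where ij: "e = {i, j}" "i < j" by (rule graph_onE[OF A])
          then have "i \<in> V" "j \<in> V - {i}" using e by (auto simp: V_def)
          then show "e \<in> adjacency_graph n ?P" using e same ij by blast
        qed
      qed
    qed
    then have "weak_convex_partition n ?P \<and> adjacency_graph n ?P = A \<longleftrightarrow>
        weak_convex_partition n ?P \<and> ?d"
      by (rule conj_cong[OF refl])
    then show ?thesis unfolding w conj_assoc .
  qed
  have "?P \<in> partitions_with_graph n A \<longleftrightarrow> weak_convex_partition n ?P \<and> adjacency_graph n ?P = A"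
    by (simp add: partitions_with_graph_def partitions_le_eq)
  also have "\<dots> \<longleftrightarrow> ?a \<and> weak_convex_partition n ?P \<and> adjacency_graph n ?P = A"
    using a by iprover
  also have "\<dots> \<longleftrightarrow> ?a \<and> ?b \<and> ?c \<and> ?d"
    using main by (rule conj_cong[OF refl])
  finally show ?thesis .
qed

lemma semialg_pred_edge_system:
  fixes T :: "(bool \<times> nat \<times> nat set) set"
  assumes "finite A" "finite W" "finite T" "\<And>s i e. (s, i, e) \<in> T \<Longrightarrow> e \<in> A"
  shows "semialg_pred (A \<times> UNIV) (\<lambda>c. \<exists>x::real^'d. (\<forall>(s, i, e)\<in>T. sat s (edge_form c i e x)) \<and>
     (\<forall>k\<in>W. \<exists>e\<in>{e\<in>A. k \<in> e}. edge_form c k e x < 0))"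
proof -
  define T' where "T' g = (\<lambda>(s, i, e). (s, 1 :: real, i, e)) ` T \<union> (\<lambda>k. (True, - 1, k, g k)) ` W"
    for g :: "nat \<Rightarrow> nat set"
  define G where "G = PiE W (\<lambda>k. {e\<in>A. k \<in> e})"
  define sg where "sg i e = (if i = Min e then - 1 else 1 :: real)" for i and e :: "nat set"
  have sys: "semialg_pred (A \<times> UNIV)
      (\<lambda>c. \<exists>x::real^'d. \<forall>t\<in>T' g. sat (fst t)
        ((\<lambda>(s, r, i, e) c. r * (sg i e * c (e, None))) t c +
         (\<Sum>l\<in>UNIV. (\<lambda>(s, r, i, e) l c. r * (sg i e * c (e, Some l))) t l c * x $ l)))"
    if g: "g \<in> G" for g
  proof (rule semialg_pred_linear_system)
    have T'A: "e \<in> A" if "(s, r, i, e) \<in> T' g" for s r i e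
      using that assms(4) g by (auto simp: T'_def G_def)
    show "finite (T' g)" using assms by (auto simp: T'_def)
    show "poly_fun (A \<times> UNIV) ((\<lambda>(s, r, i, e) c. r * (sg i e * c (e, None))) t)"
      if "t \<in> T' g" for t
      using that T'A by (cases t) (auto intro!: poly_fun_mult poly_fun_const poly_fun_var)
    show "poly_fun (A \<times> UNIV) ((\<lambda>(s, r, i, e) l c. r * (sg i e * c (e, Some l))) t l)"
      if "t \<in> T' g" for t and l :: 'd
      using that T'A by (cases t) (auto intro!: poly_fun_mult poly_fun_const poly_fun_var)
  qed
  have "finite G" unfolding G_def using assms by (intro finite_PiE) auto
  then have "semialg_pred (A \<times> UNIV)
      (\<lambda>c. \<exists>g\<in>G. \<exists>x::real^'d. \<forall>t\<in>T' g. sat (fst t)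
        ((\<lambda>(s, r, i, e) c. r * (sg i e * c (e, None))) t c +
         (\<Sum>l\<in>UNIV. (\<lambda>(s, r, i, e) l c. r * (sg i e * c (e, Some l))) t l c * x $ l)))"
    using sys by (intro semialg_pred_Bex)
  then show ?thesis
  proof (rule semialg_pred_cong)
    fix c :: "nat set \<times> 'd option \<Rightarrow> real"
    have form: "r * (sg i e * c (e, None)) + (\<Sum>l\<in>UNIV. r * (sg i e * c (e, Some l)) * x $ l)
        = r * edge_form c i e x" for r i e x
      unfolding edge_form_linear sg_def by (simp only: distrib_left sum_distrib_left mult.assoc)
    have "(\<forall>t\<in>T' g. sat (fst t) ((\<lambda>(s, r, i, e) c. r * (sg i e * c (e, None))) t c +
         (\<Sum>l\<in>UNIV. (\<lambda>(s, r, i, e) l c. r * (sg i e * c (e, Some l))) t l c * x $ l)))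
       \<longleftrightarrow> (\<forall>(s, i, e)\<in>T. sat s (edge_form c i e x)) \<and> (\<forall>k\<in>W. edge_form c k (g k) x < 0)"
      for g x
      unfolding T'_def ball_Un ball_simps
      by (simp only: split_beta fst_conv snd_conv form) (simp add: sat_def split_beta)
    moreover have "(\<exists>g\<in>G. \<forall>k\<in>W. edge_form c k (g k) x < 0) \<longleftrightarrow>
       (\<forall>k\<in>W. \<exists>e\<in>{e\<in>A. k \<in> e}. edge_form c k e x < 0)" for x
    proof
      assume "\<exists>g\<in>G. \<forall>k\<in>W. edge_form c k (g k) x < 0"
      then show "\<forall>k\<in>W. \<exists>e\<in>{e\<in>A. k \<in> e}. edge_form c k e x < 0"
        unfolding G_def by (metis PiE_mem)
    next
      assume "\<forall>k\<in>W. \<exists>e\<in>{e\<in>A. k \<in> e}. edge_form c k e x < 0"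
      then obtain g where "\<forall>k\<in>W. g k \<in> {e\<in>A. k \<in> e} \<and> edge_form c k (g k) x < 0" by metis
      then show "\<exists>g\<in>G. \<forall>k\<in>W. edge_form c k (g k) x < 0"
        by (intro bexI[of _ "restrict g W"]) (auto simp: G_def)
    qed
    ultimately show "(\<exists>g\<in>G. \<exists>x::real^'d. \<forall>t\<in>T' g. sat (fst t)
        ((\<lambda>(s, r, i, e) c. r * (sg i e * c (e, None))) t c +
         (\<Sum>l\<in>UNIV. (\<lambda>(s, r, i, e) l c. r * (sg i e * c (e, Some l))) t l c * x $ l)))
      = (\<exists>x::real^'d. (\<forall>(s, i, e)\<in>T. sat s (edge_form c i e x)) \<and>
     (\<forall>k\<in>W. \<exists>e\<in>{e\<in>A. k \<in> e}. edge_form c k e x < 0))"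
      by (simp only:) blast
  qed
qed

lemma semialg_pred_unit_vector:
  assumes "e \<in> A"
  shows "semialg_pred (A \<times> UNIV) (\<lambda>c. norm (\<chi> k::'k::finite. c (e, k)) = 1)"
proof -
  have "semialg_pred (A \<times> UNIV) (\<lambda>c. (\<Sum>k\<in>UNIV. c (e, k::'k) * c (e, k)) - 1 = 0)"
    using assms by (intro semialg_pred_zero poly_fun_diff poly_fun_sum poly_fun_mult poly_fun_var
        poly_fun_const) auto
  then show ?thesis
    by (rule semialg_pred_cong) (simp add: norm_eq_1 inner_vec_def)
qed

lemma semialgebraic_graph_params:
  assumes A: "graph_on n A"
  shows "semialgebraic (A \<times> UNIV) (graph_params n A :: (nat set \<times> 'd::finite option \<Rightarrow> real) set)"
proof -
  let ?st = "\<lambda>i. {e\<in>A. i \<in> e}"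
  have finA: "finite A" by (rule finite_graph_on[OF A])
  have finV: "finite (\<Union>A)" by (rule finite_subset[OF graph_on_vertices[OF A]]) simp
  have sys: "semialg_pred (A \<times> UNIV) \<Psi>"
    if "finite W" "U \<subseteq> \<Union>A"
      "\<And>c. \<Psi> c \<longleftrightarrow> (\<exists>x::real^'d. (\<forall>(s', i, e)\<in>{s} \<times> Sigma U ?st. sat s' (edge_form c i e x)) \<and>
        (\<forall>k\<in>W. \<exists>e\<in>?st k. edge_form c k e x < 0))" for \<Psi> s U W
  proof -
    have "semialg_pred (A \<times> UNIV) (\<lambda>c. \<exists>x::real^'d.
        (\<forall>(s', i, e)\<in>{s} \<times> Sigma U ?st. sat s' (edge_form c i e x)) \<and>
        (\<forall>k\<in>W. \<exists>e\<in>?st k. edge_form c k e x < 0))"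
      using that(1,2) finA finite_subset[OF that(2) finV]
      by (intro semialg_pred_edge_system finite_cartesian_product finite_SigmaI) auto
    then show ?thesis by (rule semialg_pred_cong) (simp add: that(3))
  qed
  have "semialg_pred (A \<times> UNIV) (\<lambda>c. (\<forall>e\<in>A. norm (\<chi> k::'d option. c (e, k)) = 1) \<and>
    (\<forall>i\<in>\<Union>A. \<exists>x::real^'d. \<forall>e\<in>?st i. edge_form c i e x > 0) \<and>
    (\<forall>i\<in>\<Union>A. \<forall>j\<in>\<Union>A - {i}. \<not> (\<exists>x::real^'d. (\<forall>e\<in>?st i. edge_form c i e x > 0) \<and>
      (\<forall>e\<in>?st j. edge_form c j e x > 0))) \<and>
    \<not> (\<exists>x::real^'d. \<forall>i\<in>\<Union>A. \<exists>e\<in>?st i. edge_form c i e x < 0) \<and>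
    (\<forall>i\<in>\<Union>A. \<forall>j\<in>\<Union>A - {i}. {i, j} \<in> A \<longleftrightarrow>
      (\<exists>x::real^'d. (\<forall>e\<in>?st i. edge_form c i e x \<ge> 0) \<and> (\<forall>e\<in>?st j. edge_form c j e x \<ge> 0) \<and>
        (\<forall>k\<in>\<Union>A - {i, j}. \<exists>e\<in>?st k. edge_form c k e x < 0))))"
  proof (intro semialg_pred_conj)
    show "semialg_pred (A \<times> UNIV) (\<lambda>c. \<forall>e\<in>A. norm (\<chi> k::'d option. c (e, k)) = 1)"
      by (intro semialg_pred_Ball finA semialg_pred_unit_vector)
    show "semialg_pred (A \<times> UNIV) (\<lambda>c. \<forall>i\<in>\<Union>A. \<exists>x::real^'d. \<forall>e\<in>?st i. edge_form c i e x > 0)"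
    proof (intro semialg_pred_Ball finV)
      fix i assume "i \<in> \<Union>A"
      then show "semialg_pred (A \<times> UNIV) (\<lambda>c. \<exists>x::real^'d. \<forall>e\<in>?st i. edge_form c i e x > 0)"
        by (intro sys[of "{}" "{i}" _ True]) (auto simp: sat_def)
    qed
    show "semialg_pred (A \<times> UNIV) (\<lambda>c. \<forall>i\<in>\<Union>A. \<forall>j\<in>\<Union>A - {i}.
      \<not> (\<exists>x::real^'d. (\<forall>e\<in>?st i. edge_form c i e x > 0) \<and> (\<forall>e\<in>?st j. edge_form c j e x > 0)))"
    proof (intro semialg_pred_Ball semialg_pred_not finV finite_Diff)
      fix i j assume "i \<in> \<Union>A" "j \<in> \<Union>A - {i}"
      then show "semialg_pred (A \<times> UNIV) (\<lambda>c. \<exists>x::real^'d. (\<forall>e\<in>?st i. edge_form c i e x > 0) \<and>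
        (\<forall>e\<in>?st j. edge_form c j e x > 0))"
        by (intro sys[of "{}" "{i, j}" _ True]) (auto simp: sat_def)
    qed
    show "semialg_pred (A \<times> UNIV)
      (\<lambda>c. \<not> (\<exists>x::real^'d. \<forall>i\<in>\<Union>A. \<exists>e\<in>?st i. edge_form c i e x < 0))"
      by (intro semialg_pred_not sys[of "\<Union>A" "{}" _ True] finV) auto
    show "semialg_pred (A \<times> UNIV) (\<lambda>c. \<forall>i\<in>\<Union>A. \<forall>j\<in>\<Union>A - {i}. {i, j} \<in> A \<longleftrightarrow>
      (\<exists>x::real^'d. (\<forall>e\<in>?st i. edge_form c i e x \<ge> 0) \<and> (\<forall>e\<in>?st j. edge_form c j e x \<ge> 0) \<and>
        (\<forall>k\<in>\<Union>A - {i, j}. \<exists>e\<in>?st k. edge_form c k e x < 0)))"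
    proof (intro semialg_pred_Ball semialg_pred_iff semialg_pred_const finV finite_Diff)
      fix i j assume ij: "i \<in> \<Union>A" "j \<in> \<Union>A - {i}"
      show "semialg_pred (A \<times> UNIV) (\<lambda>c. \<exists>x::real^'d. (\<forall>e\<in>?st i. edge_form c i e x \<ge> 0) \<and>
        (\<forall>e\<in>?st j. edge_form c j e x \<ge> 0) \<and>
        (\<forall>k\<in>\<Union>A - {i, j}. \<exists>e\<in>?st k. edge_form c k e x < 0))"
      proof (rule sys[of "\<Union>A - {i, j}" "{i, j}" _ False])
        show "finite (\<Union>A - {i, j})" using finV by simp
        show "{i, j} \<subseteq> \<Union>A" using ij by blast
        have "(\<forall>(s', i', e)\<in>{False} \<times> Sigma {i, j} ?st. sat s' (edge_form c i' e x)) \<longleftrightarrow>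
          (\<forall>e\<in>?st i. edge_form c i e x \<ge> 0) \<and> (\<forall>e\<in>?st j. edge_form c j e x \<ge> 0)"
          for c and x :: "real^'d"
          by (auto simp: sat_def)
        then show "(\<exists>x::real^'d. (\<forall>e\<in>?st i. edge_form c i e x \<ge> 0) \<and>
          (\<forall>e\<in>?st j. edge_form c j e x \<ge> 0) \<and>
          (\<forall>k\<in>\<Union>A - {i, j}. \<exists>e\<in>?st k. edge_form c k e x < 0)) \<longleftrightarrow>
          (\<exists>x::real^'d. (\<forall>(s', i', e)\<in>{False} \<times> Sigma {i, j} ?st. sat s' (edge_form c i' e x)) \<and>
          (\<forall>k\<in>\<Union>A - {i, j}. \<exists>e\<in>?st k. edge_form c k e x < 0))" for c
          by (simp only: conj_assoc)
      qed
    qed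
  qed
  then have "semialg_pred (A \<times> UNIV) (\<lambda>c. (\<forall>e\<in>A. norm (\<chi> k::'d option. c (e, k)) = 1) \<and>
      (regions n A c :: nat \<Rightarrow> (real^'d) set) \<in> partitions_with_graph n A)"
    unfolding partitions_with_graph_iff[OF A] .
  then show ?thesis by (simp add: semialg_pred_def graph_params_def)
qed

lemma finite_partitions_edgeless:
  "finite (partitions_with_graph n {} :: (nat \<Rightarrow> (real^'d) set) set)"
proof (rule finite_subset)
  show "(partitions_with_graph n {} :: (nat \<Rightarrow> (real^'d) set) set)
      \<subseteq> (\<lambda>i. \<lambda>k\<in>{1..n}. if k = i then UNIV else {}) ` {1..n}"
  proof
    fix P :: "nat \<Rightarrow> (real^'d) set" assume "P \<in> partitions_with_graph n {}"
    then have P: "weak_convex_partition n P" "adjacency_graph n P = {}"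
      by (auto simp: partitions_with_graph_def partitions_le_eq)
    have "(\<Union>i\<in>{1..n}. closure (P i)) = UNIV" using P(1) by (simp add: weak_convex_partition_def)
    then have "(0 :: real^'d) \<in> (\<Union>i\<in>{1..n}. closure (P i))" by simp
    then obtain i where i: "i \<in> {1..n}" "0 \<in> closure (P i)" by blast
    then have "P i \<noteq> {}" by auto
    then have "P i = UNIV" using isolated_region_eq_UNIV[OF P(1) i(1)] P(2) by simp
    moreover have "P k = {}" if "k \<in> {1..n}" "k \<noteq> i" for k
      using other_region_empty[OF P(1) \<open>P i = UNIV\<close> i(1) that] .
    moreover have "P k = undefined" if "k \<notin> {1..n}" for k
      using P(1) that by (auto simp: weak_convex_partition_def extensional_def)
    ultimately have "P = (\<lambda>k\<in>{1..n}. if k = i then UNIV else {})"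
      by (intro ext) (auto simp: restrict_def)
    then show "P \<in> (\<lambda>i. \<lambda>k\<in>{1..n}. if k = i then UNIV else {}) ` {1..n}" using i by blast
  qed
qed simp

lemma semialgebraically_parameterized_graph:
  assumes "graph_on n A"
  shows "semialgebraically_parameterized A (partitions_with_graph n A :: (nat \<Rightarrow> (real^'d) set) set)"
  unfolding semialgebraically_parameterized_def
  using finite_partitions_edgeless bij_betw_sep_coords[of A n]
    semialgebraic_graph_params[OF assms] by auto

lemma proper_if_same_graph:
  fixes P P' :: "nat \<Rightarrow> (real^'d) set"
  assumes P: "P \<in> proper_partitions n" and P': "P' \<in> partitions_with_graph n (adjacency_graph n P)"
  shows "P' \<in> proper_partitions n"
proof -
  have w: "weak_convex_partition n P" "\<forall>i\<in>{1..n}. P i \<noteq> {}" "weak_convex_partition n P'"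
      "adjacency_graph n P' = adjacency_graph n P"
    using P P' by (auto simp: proper_partitions_def partitions_with_graph_def partitions_le_eq)
  have "P' i \<noteq> {}" if i: "i \<in> {1..n}" for i
  proof (cases "i \<in> \<Union>(adjacency_graph n P')")
    case True
    then show ?thesis by (rule adjacency_graph_vertex_nonempty)
  next
    case False
    then have "P i = UNIV" using isolated_region_eq_UNIV[OF w(1) i] w i by auto
    have "{1..n} = {i}"
    proof (intro equalityI subsetI)
      fix k assume k: "k \<in> {1..n}"
      then show "k \<in> {i}" using other_region_empty[OF w(1) \<open>P i = UNIV\<close> i k] w(2) by blast
    qed (use i in simp)
    then have "closure (P' i) = UNIV" using w(3) by (simp add: weak_convex_partition_def)
    then show ?thesis by auto
  qed
  then show ?thesis using w(3) by (simp add: proper_partitions_def)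
qed

lemma finite_adjacency_graphs: "finite (adjacency_graph n ` X)"
  by (rule finite_subset[of _ "Pow (Pow {1..n})"]) (auto simp: adjacency_graph_def)

theorem theorem4p9:
  fixes n :: nat
  assumes "n \<ge> 1"
  shows
    "(finite (adjacency_graph n ` (partitions_le n :: (nat \<Rightarrow> (real^'d) set) set)) \<and>
      (partitions_le n :: (nat \<Rightarrow> (real^'d) set) set) =
        (\<Union>A \<in> adjacency_graph n ` (partitions_le n :: (nat \<Rightarrow> (real^'d) set) set).
           partitions_with_graph n A) \<and>
      (\<forall>A \<in> adjacency_graph n ` (partitions_le n :: (nat \<Rightarrow> (real^'d) set) set).
         semialgebraically_parameterized A
           (partitions_with_graph n A :: (nat \<Rightarrow> (real^'d) set) set)))
     \<and>
     (finite (adjacency_graph n ` (proper_partitions n :: (nat \<Rightarrow> (real^'d) set) set)) \<and>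
      (proper_partitions n :: (nat \<Rightarrow> (real^'d) set) set) =
        (\<Union>A \<in> adjacency_graph n ` (proper_partitions n :: (nat \<Rightarrow> (real^'d) set) set).
           partitions_with_graph n A) \<and>
      (\<forall>A \<in> adjacency_graph n ` (proper_partitions n :: (nat \<Rightarrow> (real^'d) set) set).
         semialgebraically_parameterized A
           (partitions_with_graph n A :: (nat \<Rightarrow> (real^'d) set) set)))"
proof -
  have "(proper_partitions n :: (nat \<Rightarrow> (real^'d) set) set) =
        (\<Union>A \<in> adjacency_graph n ` (proper_partitions n :: (nat \<Rightarrow> (real^'d) set) set).
           partitions_with_graph n A)"
  proof (intro equalityI subsetI)
    fix P :: "nat \<Rightarrow> (real^'d) set" assume "P \<in> proper_partitions n"
    then show "P \<in> (\<Union>A \<in> adjacency_graph n ` (proper_partitions n :: (nat \<Rightarrow> (real^'d) set) set).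
           partitions_with_graph n A)"
      by (auto simp: partitions_with_graph_def partitions_le_def)
  qed (auto intro: proper_if_same_graph)
  moreover have "(partitions_le n :: (nat \<Rightarrow> (real^'d) set) set) =
        (\<Union>A \<in> adjacency_graph n ` (partitions_le n :: (nat \<Rightarrow> (real^'d) set) set).
           partitions_with_graph n A)"
    by (auto simp: partitions_with_graph_def)
  ultimately show ?thesis
    by (intro conjI finite_adjacency_graphs)
      (auto intro!: semialgebraically_parameterized_graph graph_on_adjacency_graph)
qed

end
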